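(* For a general collection $\mathcal C=(C_1,\dots,C_m)$ of pinhole cameras, the multidegree $D$ of the line multiview variety $\mathcal{L}_{\mathcal{C}}$ is given by the values $$D(2,2,0,\dots,0)=1,\qquad D(2,1,1,0,\dots,0)=1,\qquad D(1,1,1,1,0,\dots,0)=2,$$ up to permutation of the arguments.
   Context: All projective spaces are complex. A pinhole camera is a full-rank matrix $C\in\mathbb C^{3\times 4}$; its center is the point $c=\ker(C)\in\mathbb P^3$. Collections have $m\ge2$ cameras with distinct centers. "General" cameras means that $\mathcal C$ is taken from a (not further specified) Zariski dense subset of the space of all camera tuples; in particular no four camera centers lie on a line. Let $\mathbb G$ be the Grassmannian of lines in $\mathbb P^3$. A line in $\mathbb P^2$ is identified with its linear equation $\ell\in\mathbb P^2$: a point $x$ is on the line if and only if $x^T\ell=0$. For a line $L\subset\mathbb P^3$ through points $x,y$ and not through the center of $C$, $C\cdot L$ denotes the line in $\mathbb P^2$ through $Cx$ and $Cy$. The joint camera map is the rational map $\Upsilon_{\mathcal C}:\mathbb G\dashrightarrow(\mathbb P^2)^m$, $L\mapsto (C_1\cdot L,\dots,C_m\cdot L)$, defined at the lines that pass through no camera center $c_i=\ker(C_i)$; the line multiview variety $\mathcal L_{\mathcal C}\subseteq(\mathbb P^2)^m$ is the Zariski closure of its image; it has dimension $4$. The multidegree of $\mathcal L_{\mathcal C}$ is the function $$D(d_1,\dots,d_m):=\#\big(\mathcal L_{\mathcal C}\cap(L_{d_1}^{(1)}\times\cdots\times L_{d_m}^{(m)})\big)$$ for $(d_1,\dots,d_m)\in\mathbb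 N^m$ with $d_1+\cdots+d_m=4$, where $L_d^{(i)}\subset\mathbb P^2$ denotes a general linear subspace of codimension $d$. (Each listed value is considered when $m$ is at least the number of its nonzero arguments.) *)

theory Defs
  imports "HOL-Analysis.Analysis" "HOL-Library.Poly_Mapping" "HOL-Library.Multiset"
    "HOL-Computational_Algebra.Polynomial"
begin

section \<open>Polynomials and the affine Zariski topology\<close>

text \<open>A complex polynomial in variables of type \<open>'v\<close> maps each exponent vector
  \<open>'v \<Rightarrow>\<^sub>0 nat\<close> to its coefficient.\<close>

type_synonym 'v cpoly = "('v \<Rightarrow>\<^sub>0 nat) \<Rightarrow>\<^sub>0 complex"

definition cpoly_eval :: "'v cpoly \<Rightarrow> ('v \<Rightarrow> complex) \<Rightarrow> complex" where
  "cpoly_eval p x =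
     (\<Sum>e\<in>Poly_Mapping.keys p. Poly_Mapping.lookup p e * (\<Prod>v\<in>Poly_Mapping.keys e. x v ^ Poly_Mapping.lookup e v))"

text \<open>In the following \<open>crd\<close> is the coordinate system of the affine space \<open>'a\<close>.\<close>

definition zariski_closure :: "('a \<Rightarrow> 'v \<Rightarrow> complex) \<Rightarrow> 'a set \<Rightarrow> 'a set" where
  "zariski_closure crd S =
     {x. \<forall>p. (\<forall>y\<in>S. cpoly_eval p (crd y) = 0) \<longrightarrow> cpoly_eval p (crd x) = 0}"

definition zariski_dense_in :: "('a \<Rightarrow> 'v \<Rightarrow> complex) \<Rightarrow> 'a set \<Rightarrow> 'a set \<Rightarrow> bool" where
  "zariski_dense_in crd X U \<longleftrightarrow> U \<subseteq> X \<and> X \<subseteq> zariski_closure crd U"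

text \<open>\<open>U\<close> is open in the subspace topology of \<open>X\<close> iff no point of \<open>U\<close> is in the
  closure of \<open>X - U\<close>.\<close>

definition zariski_open_in :: "('a \<Rightarrow> 'v \<Rightarrow> complex) \<Rightarrow> 'a set \<Rightarrow> 'a set \<Rightarrow> bool" where
  "zariski_open_in crd X U \<longleftrightarrow> U \<subseteq> X \<and> U \<inter> zariski_closure crd (X - U) = {}"


section \<open>Projective spaces and the Zariski closure in a product of planes\<close>

text \<open>The projective space of \<open>complex^'n\<close> is \<open>grassmannian 1\<close>, and the lines in
  it are \<open>grassmannian 2\<close>. A projective point \<open>p\<close> lies on a linear subspace
  \<open>L\<close> iff \<open>p \<subseteq> L\<close>. Dimensions are over the complex numbers.\<close>

definition grassmannian :: "nat \<Rightarrow> (complex^'n) set set" where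
  "grassmannian k = {S. vec.subspace S \<and> vec.dim S = k}"

text \<open>The variable \<open>(i, j)\<close> is the \<open>j\<close>-th homogeneous coordinate on the \<open>i\<close>-th
  factor.\<close>

definition multihomogeneous :: "('m \<Rightarrow> nat) \<Rightarrow> ('m \<times> 3) cpoly \<Rightarrow> bool" where
  "multihomogeneous deg f \<longleftrightarrow>
     (\<forall>e\<in>Poly_Mapping.keys f. \<forall>i. (\<Sum>j\<in>UNIV. Poly_Mapping.lookup e (i, j)) = deg i)"

definition vanishes_at :: "('m \<times> 3) cpoly \<Rightarrow> ('m \<Rightarrow> (complex^3) set) \<Rightarrow> bool" where
  "vanishes_at f p \<longleftrightarrow>
     (\<forall>x. (\<forall>i. x i \<in> p i \<and> x i \<noteq> 0) \<longrightarrow> cpoly_eval f (\<lambda>(i, j). x i $ j) = 0)"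

definition multiproj_closure ::
    "('m \<Rightarrow> (complex^3) set) set \<Rightarrow> ('m \<Rightarrow> (complex^3) set) set" where
  "multiproj_closure S =
     {p. (\<forall>i. p i \<in> grassmannian 1) \<and>
         (\<forall>deg f. multihomogeneous deg f \<and> (\<forall>q\<in>S. vanishes_at f q) \<longrightarrow> vanishes_at f p)}"


section \<open>Cameras and the line multiview variety\<close>

definition pinhole_camera :: "complex^4^3 \<Rightarrow> bool" where
  "pinhole_camera C \<longleftrightarrow> rank C = 3"

definition center :: "complex^4^3 \<Rightarrow> (complex^4) set" where
  "center C = {x. C *v x = 0}"

definition camera_tuples :: "('m \<Rightarrow> complex^4^3) set" where
  "camera_tuples = {C. (\<forall>i. pinhole_camera (C i)) \<and> inj (\<lambda>i. center (C i))}"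

definition camera_coords :: "('m \<Rightarrow> complex^4^3) \<Rightarrow> 'm \<times> 3 \<times> 4 \<Rightarrow> complex" where
  "camera_coords C = (\<lambda>(i, r, s). C i $ r $ s)"

definition no_four_centers_collinear :: "('m \<Rightarrow> complex^4^3) \<Rightarrow> bool" where
  "no_four_centers_collinear C \<longleftrightarrow>
     (\<forall>I. card I = 4 \<longrightarrow> \<not> (\<exists>L\<in>grassmannian 2. \<forall>i\<in>I. center (C i) \<subseteq> L))"

text \<open>A collection of cameras is general if it is taken from such a set.\<close>

definition general_camera_set :: "('m \<Rightarrow> complex^4^3) set \<Rightarrow> bool" where
  "general_camera_set U \<longleftrightarrow>
     zariski_dense_in camera_coords camera_tuples U \<and>
     (\<forall>C\<in>U. no_four_centers_collinear C)"

text \<open>\<open>scalar_product\<close> is bilinear over the complex numbers, unlike the inner product.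
  For a line \<open>M\<close> this is the dual point given by its linear equation.\<close>

definition line_equation :: "(complex^3) set \<Rightarrow> (complex^3) set" where
  "line_equation M = {l. \<forall>x\<in>M. scalar_product x l = 0}"

definition camera_line :: "complex^4^3 \<Rightarrow> (complex^4) set \<Rightarrow> (complex^3) set" where
  "camera_line C L = line_equation ((\<lambda>x. C *v x) ` L)"

definition joint_camera_domain :: "('m \<Rightarrow> complex^4^3) \<Rightarrow> (complex^4) set set" where
  "joint_camera_domain C = {L \<in> grassmannian 2. \<forall>i. \<not> center (C i) \<subseteq> L}"

definition joint_camera_map ::
    "('m \<Rightarrow> complex^4^3) \<Rightarrow> (complex^4) set \<Rightarrow> 'm \<Rightarrow> (complex^3) set" where
  "joint_camera_map C L = (\<lambda>i. camera_line (C i) L)"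

definition line_multiview_variety ::
    "('m \<Rightarrow> complex^4^3) \<Rightarrow> ('m \<Rightarrow> (complex^3) set) set" where
  "line_multiview_variety C = multiproj_closure (joint_camera_map C ` joint_camera_domain C)"


section \<open>The multidegree\<close>

text \<open>A general linear subspace of codimension \<open>d\<close> in the plane is the zero locus of \<open>d\<close>
  general linear forms. For each factor \<open>i\<close> there are \<open>d i\<close> forms, given by their
  coefficient vectors \<open>A i 0\<close>, \<open>\<dots>\<close>, \<open>A i (d i - 1)\<close>; the other values
  of \<open>A i\<close> are fixed to \<open>0\<close>, so that \<open>linear_forms d\<close> is an affine space with
  finitely many coordinates.\<close>

definition linear_forms :: "('m \<Rightarrow> nat) \<Rightarrow> ('m \<Rightarrow> nat \<Rightarrow> complex^3) set" where
  "linear_forms d = {A. \<forall>i k. d i \<le> k \<longrightarrow> A i k = 0}"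

definition form_coords :: "('m \<Rightarrow> nat \<Rightarrow> complex^3) \<Rightarrow> 'm \<times> nat \<times> 3 \<Rightarrow> complex" where
  "form_coords A = (\<lambda>(i, k, j). A i k $ j)"

definition forms_locus :: "nat \<Rightarrow> (nat \<Rightarrow> complex^3) \<Rightarrow> (complex^3) set" where
  "forms_locus d a = {x. \<forall>k<d. scalar_product (a k) x = 0}"

definition linear_section ::
    "('m \<Rightarrow> (complex^3) set) set \<Rightarrow> ('m \<Rightarrow> nat) \<Rightarrow> ('m \<Rightarrow> nat \<Rightarrow> complex^3) \<Rightarrow>
     ('m \<Rightarrow> (complex^3) set) set" where
  "linear_section X d A = {p \<in> X. \<forall>i. p i \<subseteq> forms_locus (d i) (A i)}"

text \<open>\<open>has_multidegree X d n\<close> says that the multidegree of \<open>X\<close> at \<open>d\<close> is \<open>n\<close>: the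
  section is finite with \<open>n\<close> points for all linear subspaces in a nonempty Zariski open set.\<close>

definition has_multidegree ::
    "('m \<Rightarrow> (complex^3) set) set \<Rightarrow> ('m \<Rightarrow> nat) \<Rightarrow> nat \<Rightarrow> bool" where
  "has_multidegree X d n \<longleftrightarrow>
     (\<exists>V. zariski_open_in form_coords (linear_forms d) V \<and> V \<noteq> {} \<and>
        (\<forall>A\<in>V. finite (linear_section X d A) \<and> card (linear_section X d A) = n))"

text \<open>The multidegree is a (partial) function of \<open>d\<close>, since nonempty Zariski open sets
  of linear forms meet.\<close>

lemma cpoly_eval_on_line:
  "\<exists>P. \<forall>t. poly P t = cpoly_eval p (\<lambda>v. x v + t * (y v - x v))"
  by (rule exI[of _ "\<Sum>e\<in>Poly_Mapping.keys p. smult (Poly_Mapping.lookup p e)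
        (\<Prod>v\<in>Poly_Mapping.keys e. [:x v, y v - x v:] ^ Poly_Mapping.lookup e v)"])
     (simp add: cpoly_eval_def poly_sum poly_prod poly_power)

lemma zariski_open_linear_forms_meet:
  assumes "zariski_open_in form_coords (linear_forms d) V" "V \<noteq> {}"
    and "zariski_open_in form_coords (linear_forms d) W" "W \<noteq> {}"
  shows "V \<inter> W \<noteq> {}"
proof -
  have *: "\<exists>a p. a \<in> linear_forms d \<and> cpoly_eval p (form_coords a) \<noteq> 0 \<and>
      (\<forall>A\<in>linear_forms d - Z. cpoly_eval p (form_coords A) = 0)"
    if Z: "zariski_open_in form_coords (linear_forms d) Z" "Z \<noteq> {}" for Z
  proof -
    obtain a where "a \<in> Z" using Z(2) by auto
    with Z(1) have "a \<in> linear_forms d" "a \<notin> zariski_closure form_coords (linear_forms d - Z)"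
      by (auto simp only: zariski_open_in_def)
    then show ?thesis
      by (auto simp only: zariski_closure_def mem_Collect_eq)
  qed
  obtain a p where a: "a \<in> linear_forms d" "cpoly_eval p (form_coords a) \<noteq> 0"
    and p: "\<And>A. A \<in> linear_forms d - V \<Longrightarrow> cpoly_eval p (form_coords A) = 0"
    using *[OF assms(1,2)] by metis
  obtain b q where b: "b \<in> linear_forms d" "cpoly_eval q (form_coords b) \<noteq> 0"
    and q: "\<And>A. A \<in> linear_forms d - W \<Longrightarrow> cpoly_eval q (form_coords A) = 0"
    using *[OF assms(3,4)] by metis
  define c where "c t = (\<lambda>i k. a i k + t *s (b i k - a i k))" for t :: complex
  have c_in: "c t \<in> linear_forms d" for t
    using a(1) b(1) by (auto simp: c_def linear_forms_def)
  have crd: "form_coords (c t) =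
      (\<lambda>v. form_coords a v + t * (form_coords b v - form_coords a v))" for t
    by (auto simp: form_coords_def c_def fun_eq_iff algebra_simps)
  obtain P where P: "\<And>t. poly P t = cpoly_eval p (form_coords (c t))"
    using cpoly_eval_on_line unfolding crd by metis
  obtain Q where Q: "\<And>t. poly Q t = cpoly_eval q (form_coords (c t))"
    using cpoly_eval_on_line unfolding crd by metis
  have "c 0 = a" "c 1 = b"
    by (auto simp: c_def fun_eq_iff)
  then have "poly P 0 \<noteq> 0" "poly Q 1 \<noteq> 0"
    using a b by (simp_all add: P Q)
  then have "P * Q \<noteq> 0"
    by auto
  then have "finite {t. poly (P * Q) t = 0}"
    by (rule poly_roots_finite)
  then obtain t where "poly (P * Q) t \<noteq> 0"
    using ex_new_if_finite[OF infinite_UNIV_char_0] by blast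
  then have "c t \<in> V" "c t \<in> W"
    using p[of "c t"] q[of "c t"] c_in[of t] P[of t] Q[of t] by auto
  then show ?thesis by blast
qed

lemma has_multidegree_unique:
  assumes "has_multidegree X d n" "has_multidegree X d n'"
  shows "n = n'"
proof -
  obtain V where V: "zariski_open_in form_coords (linear_forms d) V" "V \<noteq> {}"
      "\<forall>A\<in>V. card (linear_section X d A) = n"
    using assms(1) by (auto simp only: has_multidegree_def)
  obtain W where W: "zariski_open_in form_coords (linear_forms d) W" "W \<noteq> {}"
      "\<forall>A\<in>W. card (linear_section X d A) = n'"
    using assms(2) by (auto simp only: has_multidegree_def)
  obtain A where "A \<in> V" "A \<in> W"
    using zariski_open_linear_forms_meet[OF V(1,2) W(1,2)] by auto
  with V(3) W(3) show ?thesis by auto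
qed

text \<open>The nonzero values of \<open>d\<close> with multiplicity, which determine \<open>d\<close> up to
  permutation of the arguments.\<close>

definition nonzero_args :: "('m::finite \<Rightarrow> nat) \<Rightarrow> nat multiset" where
  "nonzero_args d = image_mset d (mset_set {i. d i \<noteq> 0})"

end

theory Submission
  imports Defs
begin

text \<open>
  A point of the variety is a tuple of image lines. The image line \<open>x\<close> of camera \<open>i\<close> has
  the back-projected plane \<open>{y. x \<cdot> C\<^sub>i y = 0}\<close> through the center \<open>c\<^sub>i\<close>. The planes of the image of a
  line \<open>L\<close> all contain \<open>L\<close>, so any three of them are linearly dependent. This is a
  multihomogeneous condition, hence it holds on the whole variety
  (\<open>line_multiview_variety_rank\<close>). Consequently, as soon as two of the planes of a point
  of the variety are distinct, all planes share a line \<open>L\<close>, and if \<open>L\<close> avoids the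
  centers, the point is the image of \<open>L\<close>. Intersecting the variety with linear spaces in
  general position thus becomes a question on lines in space (\<open>joint_camera_map_bij\<close>).

  A linear form on the dual of image plane \<open>i\<close> is a point of that image plane, and it
  back-projects to a ray through \<open>c\<^sub>i\<close>. One form forces \<open>L\<close> to meet this ray. Two forms force
  \<open>L\<close> to lie in the plane of the two rays. So the following lines have to be counted.
  \<^item> \<open>(2,2)\<close>: lines in two planes. The only one is their intersection.
  \<^item> \<open>(2,1,1)\<close>: lines in one plane that meet two rays. The only one joins the points in which
    the rays meet the plane.
  \<^item> \<open>(1,1,1,1)\<close>: lines that meet four rays. Joining a point of the first ray to a point of the
    second one leaves two bilinear equations in two unknowns, which have two
    solutions (\<open>two_bilinear_equations\<close>).

  For special forms the count can be different, and a line that meets the rays can pass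
  through a center. Each such exception is excluded by the nonvanishing of one polynomial.
  By irreducibility of affine space, finitely many polynomials that are not identically zero
  have a common point of nonvanishing, so each polynomial needs only its own witness. The
  witnesses for the conditions on rays are mostly rays that join centers. They work because
  up to four centers are independent, and this is what is required here of general cameras.\<close>

section \<open>Polynomial functions and generic points\<close>

definition polynomial_fun :: "('a \<Rightarrow> 'v \<Rightarrow> complex) \<Rightarrow> ('a \<Rightarrow> complex) \<Rightarrow> bool" where
  "polynomial_fun crd f \<longleftrightarrow> (\<exists>p. \<forall>a. f a = cpoly_eval p (crd a))"

lemma cpoly_eval_superset:
  assumes "finite K" "Poly_Mapping.keys p \<subseteq> K"
  shows "cpoly_eval p x =
     (\<Sum>e\<in>K. Poly_Mapping.lookup p e * (\<Prod>v\<in>Poly_Mapping.keys e. x v ^ Poly_Mapping.lookup e v))"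
  unfolding cpoly_eval_def
  by (rule sum.mono_neutral_left) (use assms in \<open>auto simp: in_keys_iff\<close>)

lemma cpoly_eval_add: "cpoly_eval (p + q) x = cpoly_eval p x + cpoly_eval q x"
proof -
  let ?K = "Poly_Mapping.keys p \<union> Poly_Mapping.keys q"
  have "Poly_Mapping.keys (p + q) \<subseteq> ?K" by (rule Poly_Mapping.keys_add)
  then show ?thesis
    by (simp add: cpoly_eval_superset[of ?K] lookup_add algebra_simps sum.distrib)
qed

lemma cpoly_eval_zero [simp]: "cpoly_eval 0 x = 0"
  by (simp add: cpoly_eval_def)

lemma cpoly_eval_sum: "cpoly_eval (\<Sum>i\<in>I. p i) x = (\<Sum>i\<in>I. cpoly_eval (p i) x)"
  by (induction I rule: infinite_finite_induct) (auto simp: cpoly_eval_add)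

lemma cpoly_eval_single:
  "cpoly_eval (Poly_Mapping.single e c) x
     = c * (\<Prod>v\<in>Poly_Mapping.keys e. x v ^ Poly_Mapping.lookup e v)"
  by (simp add: cpoly_eval_superset[of "{e}"])

lemma cpoly_eval_single_0 [simp]: "cpoly_eval (Poly_Mapping.single 0 c) x = c"
  by (simp add: cpoly_eval_single)

lemma cpoly_eval_one [simp]: "cpoly_eval 1 x = 1"
  using cpoly_eval_single_0[of 1 x] by simp

lemma cpoly_eval_single_var [simp]:
  "cpoly_eval (Poly_Mapping.single (Poly_Mapping.single v (Suc 0)) c) x = c * x v"
  by (simp add: cpoly_eval_single)

text \<open>Both sides can be written over the common index set of variables that occur in either monomial.\<close>

lemma monomial_eval_add:
  fixes a b :: "'v \<Rightarrow>\<^sub>0 nat" and x :: "'v \<Rightarrow> complex"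
  shows "(\<Prod>v\<in>Poly_Mapping.keys (a + b). x v ^ Poly_Mapping.lookup (a + b) v)
    = (\<Prod>v\<in>Poly_Mapping.keys a. x v ^ Poly_Mapping.lookup a v)
      * (\<Prod>v\<in>Poly_Mapping.keys b. x v ^ Poly_Mapping.lookup b v)"
proof -
  let ?K = "Poly_Mapping.keys a \<union> Poly_Mapping.keys b"
  have superset: "(\<Prod>v\<in>Poly_Mapping.keys e. x v ^ Poly_Mapping.lookup e v)
      = (\<Prod>v\<in>?K. x v ^ Poly_Mapping.lookup e v)" if "Poly_Mapping.keys e \<subseteq> ?K" for e
    by (rule prod.mono_neutral_left) (use that in \<open>auto simp: in_keys_iff\<close>)
  show ?thesis
    unfolding superset[OF Poly_Mapping.keys_add] superset[OF Un_upper1] superset[OF Un_upper2]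
    by (simp add: lookup_add power_add prod.distrib)
qed

lemma cpoly_eval_mult: "cpoly_eval (p * q) x = cpoly_eval p x * cpoly_eval q x"
proof -
  have monomials: "r = (\<Sum>e\<in>Poly_Mapping.keys r. Poly_Mapping.single e (Poly_Mapping.lookup r e))"
    for r :: "'a cpoly"
    by (rule poly_mapping_eqI)
       (auto simp: lookup_sum lookup_single when_def in_keys_iff)
  have "cpoly_eval (p * q) x =
      cpoly_eval ((\<Sum>e\<in>Poly_Mapping.keys p. Poly_Mapping.single e (Poly_Mapping.lookup p e))
        * (\<Sum>e\<in>Poly_Mapping.keys q. Poly_Mapping.single e (Poly_Mapping.lookup q e))) x"
    using monomials[of p] monomials[of q] by simp
  also have "\<dots> = cpoly_eval p x * cpoly_eval q x"
    unfolding sum_product cpoly_eval_sum mult_single cpoly_eval_single monomial_eval_add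
      cpoly_eval_def[of p] cpoly_eval_def[of q]
    by (simp add: mult_ac)
  finally show ?thesis .
qed

named_theorems polynomial_intros

lemma polynomial_fun_const [polynomial_intros]: "polynomial_fun crd (\<lambda>a. c)"
  unfolding polynomial_fun_def by (rule exI[of _ "Poly_Mapping.single 0 c"]) simp

lemma polynomial_fun_coord: "polynomial_fun crd (\<lambda>a. crd a v)"
  unfolding polynomial_fun_def
  by (rule exI[of _ "Poly_Mapping.single (Poly_Mapping.single v 1) 1"]) simp

lemma polynomial_fun_add [polynomial_intros]:
  "polynomial_fun crd f \<Longrightarrow> polynomial_fun crd g \<Longrightarrow> polynomial_fun crd (\<lambda>a. f a + g a)"
  unfolding polynomial_fun_def by (metis cpoly_eval_add)

lemma polynomial_fun_mult [polynomial_intros]: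
  "polynomial_fun crd f \<Longrightarrow> polynomial_fun crd g \<Longrightarrow> polynomial_fun crd (\<lambda>a. f a * g a)"
  unfolding polynomial_fun_def by (metis cpoly_eval_mult)

lemma polynomial_fun_uminus [polynomial_intros]:
  "polynomial_fun crd f \<Longrightarrow> polynomial_fun crd (\<lambda>a. - f a)"
  using polynomial_fun_mult[OF polynomial_fun_const[of crd "-1"], of f] by simp

lemma polynomial_fun_diff [polynomial_intros]:
  "polynomial_fun crd f \<Longrightarrow> polynomial_fun crd g \<Longrightarrow> polynomial_fun crd (\<lambda>a. f a - g a)"
  using polynomial_fun_add[OF _ polynomial_fun_uminus, of crd f g] by simp

lemma polynomial_fun_power [polynomial_intros]:
  "polynomial_fun crd f \<Longrightarrow> polynomial_fun crd (\<lambda>a. f a ^ n)"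
  by (induction n) (auto intro: polynomial_intros)

lemma polynomial_fun_sum [polynomial_intros]:
  "(\<And>i. i \<in> I \<Longrightarrow> polynomial_fun crd (f i)) \<Longrightarrow> polynomial_fun crd (\<lambda>a. \<Sum>i\<in>I. f i a)"
  by (induction I rule: infinite_finite_induct) (auto intro: polynomial_intros)

lemma polynomial_fun_matrix_vector_mult [polynomial_intros]:
  assumes "\<And>j. polynomial_fun crd (\<lambda>a. f a $ j)"
  shows "polynomial_fun crd (\<lambda>a. (M *v f a) $ i)"
  unfolding matrix_vector_mult_def by (auto intro!: polynomial_intros assms)

text \<open>The two spaces of interest, all camera tuples and the linear forms, are affine spaces in
  their coordinates. All that is used of this is that the line through two points stays
  in the space, so that questions on several variables reduce to polynomials in one variable.\<close>

definition closed_under_lines :: "('a \<Rightarrow> 'v \<Rightarrow> complex) \<Rightarrow> 'a set \<Rightarrow> bool" where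
  "closed_under_lines crd X \<longleftrightarrow>
     (\<forall>a\<in>X. \<forall>b\<in>X. \<forall>t. \<exists>c\<in>X. crd c = (\<lambda>v. crd a v + t * (crd b v - crd a v)))"

text \<open>The property holds on a nonempty principal open set. As the set is given by a single
  polynomial, conjunctions correspond to products.\<close>

definition generically :: "('a \<Rightarrow> 'v \<Rightarrow> complex) \<Rightarrow> 'a set \<Rightarrow> ('a \<Rightarrow> bool) \<Rightarrow> bool" where
  "generically crd X P \<longleftrightarrow> (\<exists>p. (\<exists>a\<in>X. cpoly_eval p (crd a) \<noteq> 0) \<and>
     (\<forall>a\<in>X. cpoly_eval p (crd a) \<noteq> 0 \<longrightarrow> P a))"

lemma generically_nonzero:
  assumes "polynomial_fun crd f" "a \<in> X" "f a \<noteq> 0"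
  shows "generically crd X (\<lambda>a. f a \<noteq> 0)"
  using assms unfolding polynomial_fun_def generically_def by metis

lemma generically_mono:
  assumes "generically crd X P" "\<And>a. a \<in> X \<Longrightarrow> P a \<Longrightarrow> Q a"
  shows "generically crd X Q"
  using assms unfolding generically_def by metis

text \<open>Irreducibility: restricted to the line through the two points, the two polynomials
  become nonzero polynomials in one variable, and these have only finitely many roots.\<close>

lemma nonzero_on_common_point_of_line:
  assumes "closed_under_lines crd X"
    and "a \<in> X" "cpoly_eval p (crd a) \<noteq> 0" and "b \<in> X" "cpoly_eval q (crd b) \<noteq> 0"
  shows "\<exists>c\<in>X. cpoly_eval p (crd c) \<noteq> 0 \<and> cpoly_eval q (crd c) \<noteq> 0"
proof -
  obtain P where P: "\<And>t. poly P t = cpoly_eval p (\<lambda>v. crd a v + t * (crd b v - crd a v))"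
    using cpoly_eval_on_line by metis
  obtain Q where Q: "\<And>t. poly Q t = cpoly_eval q (\<lambda>v. crd a v + t * (crd b v - crd a v))"
    using cpoly_eval_on_line by metis
  have "poly P 0 \<noteq> 0" "poly Q 1 \<noteq> 0"
    using assms by (simp_all add: P Q)
  then have "P * Q \<noteq> 0" by auto
  then have "finite {t. poly (P * Q) t = 0}" by (rule poly_roots_finite)
  then obtain t where "poly (P * Q) t \<noteq> 0"
    using ex_new_if_finite[OF infinite_UNIV_char_0] by blast
  moreover obtain c where "c \<in> X" "crd c = (\<lambda>v. crd a v + t * (crd b v - crd a v))"
    using assms unfolding closed_under_lines_def by blast
  ultimately show ?thesis
    using P[of t] Q[of t] by (intro bexI[of _ c]) auto
qed

lemma generically_conj:
  assumes "closed_under_lines crd X" "generically crd X P" "generically crd X Q"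
  shows "generically crd X (\<lambda>a. P a \<and> Q a)"
proof -
  obtain p a where p: "a \<in> X" "cpoly_eval p (crd a) \<noteq> 0"
    "\<And>a. a \<in> X \<Longrightarrow> cpoly_eval p (crd a) \<noteq> 0 \<Longrightarrow> P a"
    using assms(2) unfolding generically_def by blast
  obtain q b where q: "b \<in> X" "cpoly_eval q (crd b) \<noteq> 0"
    "\<And>a. a \<in> X \<Longrightarrow> cpoly_eval q (crd a) \<noteq> 0 \<Longrightarrow> Q a"
    using assms(3) unfolding generically_def by blast
  obtain c where "c \<in> X" "cpoly_eval p (crd c) \<noteq> 0" "cpoly_eval q (crd c) \<noteq> 0"
    using nonzero_on_common_point_of_line[OF assms(1)] p(1,2) q(1,2) by blast
  then show ?thesis
    unfolding generically_def
    by (intro exI[of _ "p * q"]) (auto simp: cpoly_eval_mult p(3) q(3))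
qed

lemma generically_True: "X \<noteq> {} \<Longrightarrow> generically crd X (\<lambda>a. True)"
  unfolding generically_def by (rule exI[of _ 1]) auto

lemma generically_ball:
  assumes "closed_under_lines crd X" "X \<noteq> {}" "finite I"
    and "\<And>i. i \<in> I \<Longrightarrow> generically crd X (P i)"
  shows "generically crd X (\<lambda>a. \<forall>i\<in>I. P i a)"
  using assms(3,4)
  by (induction I rule: finite_induct) (auto intro: generically_True[OF assms(2)] generically_conj[OF assms(1)])

lemma generically_all:
  fixes P :: "'i::finite \<Rightarrow> 'a \<Rightarrow> bool"
  assumes "closed_under_lines crd X" "X \<noteq> {}" "\<And>i. generically crd X (P i)"
  shows "generically crd X (\<lambda>a. \<forall>i. P i a)"
  using generically_ball[OF assms(1,2), of UNIV P] assms(3) by simp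

lemma generically_imp:
  assumes "X \<noteq> {}" "Q \<Longrightarrow> generically crd X P"
  shows "generically crd X (\<lambda>a. Q \<longrightarrow> P a)"
  by (cases Q) (simp_all add: assms generically_True)

text \<open>If a polynomial vanished on the generic points but not at \<open>b\<close>, then it and the polynomial
  that defines the generic points would have a common point of nonvanishing.\<close>

lemma generically_dense:
  assumes "closed_under_lines crd X" "generically crd X P" "Y \<subseteq> X"
  shows "Y \<subseteq> zariski_closure crd {a\<in>X. P a}"
proof
  fix b assume "b \<in> Y"
  obtain q a where q: "a \<in> X" "cpoly_eval q (crd a) \<noteq> 0"
    "\<And>a. a \<in> X \<Longrightarrow> cpoly_eval q (crd a) \<noteq> 0 \<Longrightarrow> P a"
    using assms(2) unfolding generically_def by blast
  have "cpoly_eval p (crd b) = 0" if "\<forall>y\<in>{a\<in>X. P a}. cpoly_eval p (crd y) = 0" for p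
  proof (rule ccontr)
    assume "cpoly_eval p (crd b) \<noteq> 0"
    then obtain c where "c \<in> X" "cpoly_eval p (crd c) \<noteq> 0" "cpoly_eval q (crd c) \<noteq> 0"
      using nonzero_on_common_point_of_line[OF assms(1)] q(1,2) assms(3) \<open>b \<in> Y\<close> by blast
    with that q(3) show False by blast
  qed
  then show "b \<in> zariski_closure crd {a\<in>X. P a}"
    unfolding zariski_closure_def by blast
qed

lemma closed_under_lines_linear_forms: "closed_under_lines form_coords (linear_forms d)"
  unfolding closed_under_lines_def
proof (intro ballI allI)
  fix a b :: "'a \<Rightarrow> nat \<Rightarrow> complex^3" and t
  assume "a \<in> linear_forms d" "b \<in> linear_forms d"
  then show "\<exists>c\<in>linear_forms d. form_coords c
      = (\<lambda>v. form_coords a v + t * (form_coords b v - form_coords a v))"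
    by (intro bexI[of _ "\<lambda>i k. a i k + t *s (b i k - a i k)"])
       (auto simp: form_coords_def linear_forms_def fun_eq_iff algebra_simps)
qed

lemma closed_under_lines_cameras: "closed_under_lines camera_coords UNIV"
  unfolding closed_under_lines_def
proof (intro ballI allI)
  fix a b :: "'a \<Rightarrow> complex^4^3" and t
  show "\<exists>c\<in>UNIV. camera_coords c
      = (\<lambda>v. camera_coords a v + t * (camera_coords b v - camera_coords a v))"
    by (intro bexI[of _ "\<lambda>i. \<chi> r s. a i $ r $ s + t * (b i $ r $ s - a i $ r $ s)"])
       (auto simp: camera_coords_def fun_eq_iff)
qed

lemma polynomial_fun_form_coords [polynomial_intros]:
  "polynomial_fun form_coords (\<lambda>A. A i k $ j)"
  using polynomial_fun_coord[of form_coords "(i, k, j)"] by (simp add: form_coords_def)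

lemma polynomial_fun_camera_coords [polynomial_intros]:
  "polynomial_fun camera_coords (\<lambda>C. C i $ r $ s)"
  using polynomial_fun_coord[of camera_coords "(i, r, s)"] by (simp add: camera_coords_def)

lemma has_multidegree_if_generically:
  assumes "generically form_coords (linear_forms d)
    (\<lambda>A. finite (linear_section X d A) \<and> card (linear_section X d A) = n)"
  shows "has_multidegree X d n"
proof -
  obtain p where p: "\<exists>a\<in>linear_forms d. cpoly_eval p (form_coords a) \<noteq> 0"
    "\<And>A. A \<in> linear_forms d \<Longrightarrow> cpoly_eval p (form_coords A) \<noteq> 0 \<Longrightarrow>
      finite (linear_section X d A) \<and> card (linear_section X d A) = n"
    using assms unfolding generically_def by blast
  let ?V = "{A \<in> linear_forms d. cpoly_eval p (form_coords A) \<noteq> 0}"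
  have "zariski_open_in form_coords (linear_forms d) ?V"
    unfolding zariski_open_in_def zariski_closure_def by blast
  with p show ?thesis
    unfolding has_multidegree_def by (intro exI[of _ ?V]) auto
qed

text \<open>A vector polynomial is nonzero wherever a fixed component is, and the witness selects the component.\<close>

lemma generically_vector_nonzero:
  fixes f :: "'a \<Rightarrow> complex^'n"
  assumes "\<And>s. polynomial_fun crd (\<lambda>a. f a $ s)" "a \<in> X" "f a \<noteq> 0"
  shows "generically crd X (\<lambda>a. f a \<noteq> 0)"
proof -
  obtain s where "f a $ s \<noteq> 0" using assms(3) by (auto simp: vec_eq_iff)
  then have "generically crd X (\<lambda>a. f a $ s \<noteq> 0)"
    by (rule generically_nonzero[OF assms(1,2)])
  then show ?thesis by (rule generically_mono) auto
qed

section \<open>Determinants and cross products in dimensions three and four\<close>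

notation scalar_product (infixl "\<cdot>" 75)

lemma scalar_product_3: "(x :: complex^3) \<cdot> y = x$1 * y$1 + x$2 * y$2 + x$3 * y$3"
  by (simp add: scalar_product_def sum_3)

lemma scalar_product_4: "(x :: complex^4) \<cdot> y = x$1 * y$1 + x$2 * y$2 + x$3 * y$3 + x$4 * y$4"
  by (simp add: scalar_product_def sum_4)

lemma scalar_product_simps [simp]:
  fixes x y z :: "complex^'n"
  shows "x \<cdot> (y + z) = x \<cdot> y + x \<cdot> z" "(x + y) \<cdot> z = x \<cdot> z + y \<cdot> z"
    "x \<cdot> (y - z) = x \<cdot> y - x \<cdot> z" "(x - y) \<cdot> z = x \<cdot> z - y \<cdot> z"
    "x \<cdot> (a *s y) = a * (x \<cdot> y)" "(a *s x) \<cdot> y = a * (x \<cdot> y)"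
    "x \<cdot> 0 = 0" "0 \<cdot> x = 0"
  by (simp_all add: scalar_product_def ring_distribs sum.distrib sum_subtractf sum_distrib_left
      mult.assoc mult.left_commute[of _ a])

lemma scalar_product_commute: "(x :: complex^'n) \<cdot> y = y \<cdot> x"
  by (simp add: scalar_product_def mult.commute)

lemma scalar_product_matrix_vector:
  "(x :: complex^3) \<cdot> (C *v y) = (x$1 *s C$1 + x$2 *s C$2 + x$3 *s C$3) \<cdot> (y :: complex^4)"
  by (simp add: scalar_product_3 scalar_product_4 matrix_vector_mult_def sum_4 algebra_simps)

lemma vec_eq_3: "(x :: complex^3) = y \<longleftrightarrow> x$1 = y$1 \<and> x$2 = y$2 \<and> x$3 = y$3"
  by (simp add: vec_eq_iff forall_3)

lemma vec_eq_4: "(x :: complex^4) = y \<longleftrightarrow> x$1 = y$1 \<and> x$2 = y$2 \<and> x$3 = y$3 \<and> x$4 = y$4"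
  by (simp add: vec_eq_iff forall_4)

lemma scalar_product_nondegenerate:
  assumes "(x :: complex^'n) \<noteq> 0" obtains y where "x \<cdot> y \<noteq> 0"
proof -
  obtain j where "x $ j \<noteq> 0" using assms by (auto simp: vec_eq_iff)
  then have "x \<cdot> axis j 1 \<noteq> 0"
    by (simp add: scalar_product_def axis_def if_distrib cong: if_cong)
  then show ?thesis by (rule that)
qed

text \<open>The minor of the rows \<open>a\<close>, \<open>b\<close>, \<open>c\<close> in the columns \<open>i\<close>, \<open>j\<close>, \<open>k\<close>.\<close>

definition minor3 :: "complex^'n \<Rightarrow> complex^'n \<Rightarrow> complex^'n \<Rightarrow> 'n \<Rightarrow> 'n \<Rightarrow> 'n \<Rightarrow> complex" where
  "minor3 a b c i j k = a$i * (b$j * c$k - b$k * c$j)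
     - a$j * (b$i * c$k - b$k * c$i) + a$k * (b$i * c$j - b$j * c$i)"

definition det3 :: "complex^3 \<Rightarrow> complex^3 \<Rightarrow> complex^3 \<Rightarrow> complex" where
  "det3 a b c = minor3 a b c 1 2 3"

definition cross :: "complex^3 \<Rightarrow> complex^3 \<Rightarrow> complex^3" where
  "cross a b = (\<chi> i. if i = 1 then a$2 * b$3 - a$3 * b$2
     else if i = 2 then a$3 * b$1 - a$1 * b$3 else a$1 * b$2 - a$2 * b$1)"

text \<open>The signs are those of the Laplace expansion, so that pairing with a fourth vector gives
  the determinant.\<close>

definition cross4 :: "complex^4 \<Rightarrow> complex^4 \<Rightarrow> complex^4 \<Rightarrow> complex^4" where
  "cross4 b c d = (\<chi> s. if s = 1 then minor3 b c d 2 3 4 else if s = 2 then - minor3 b c d 1 3 4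
     else if s = 3 then minor3 b c d 1 2 4 else - minor3 b c d 1 2 3)"

definition det4 :: "complex^4 \<Rightarrow> complex^4 \<Rightarrow> complex^4 \<Rightarrow> complex^4 \<Rightarrow> complex" where
  "det4 a b c d = a \<cdot> cross4 b c d"

lemma cross_nth [simp]:
  "cross a b $ 1 = a$2 * b$3 - a$3 * b$2"
  "cross a b $ 2 = a$3 * b$1 - a$1 * b$3"
  "cross a b $ 3 = a$1 * b$2 - a$2 * b$1"
  by (simp_all add: cross_def)

lemma cross4_nth [simp]:
  "cross4 b c d $ 1 = minor3 b c d 2 3 4"
  "cross4 b c d $ 2 = - minor3 b c d 1 3 4"
  "cross4 b c d $ 3 = minor3 b c d 1 2 4"
  "cross4 b c d $ 4 = - minor3 b c d 1 2 3"
  by (simp_all add: cross4_def)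

lemma minor3_linear [simp]:
  "minor3 (a + a') b c i j k = minor3 a b c i j k + minor3 a' b c i j k"
  "minor3 a (b + b') c i j k = minor3 a b c i j k + minor3 a b' c i j k"
  "minor3 a b (c + c') i j k = minor3 a b c i j k + minor3 a b c' i j k"
  "minor3 (a - a') b c i j k = minor3 a b c i j k - minor3 a' b c i j k"
  "minor3 a (b - b') c i j k = minor3 a b c i j k - minor3 a b' c i j k"
  "minor3 a b (c - c') i j k = minor3 a b c i j k - minor3 a b c' i j k"
  "minor3 (t *s a) b c i j k = t * minor3 a b c i j k"
  "minor3 a (t *s b) c i j k = t * minor3 a b c i j k"
  "minor3 a b (t *s c) i j k = t * minor3 a b c i j k"
  "minor3 0 b c i j k = 0" "minor3 a 0 c i j k = 0" "minor3 a b 0 i j k = 0"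
  "minor3 a a c i j k = 0" "minor3 a b a i j k = 0" "minor3 a b b i j k = 0"
  by (simp_all add: minor3_def algebra_simps)

lemma det3_linear [simp]:
  "det3 (a + a') b c = det3 a b c + det3 a' b c"
  "det3 a (b + b') c = det3 a b c + det3 a b' c"
  "det3 a b (c + c') = det3 a b c + det3 a b c'"
  "det3 (a - a') b c = det3 a b c - det3 a' b c"
  "det3 a (b - b') c = det3 a b c - det3 a b' c"
  "det3 a b (c - c') = det3 a b c - det3 a b c'"
  "det3 (t *s a) b c = t * det3 a b c"
  "det3 a (t *s b) c = t * det3 a b c"
  "det3 a b (t *s c) = t * det3 a b c"
  "det3 0 b c = 0" "det3 a 0 c = 0" "det3 a b 0 = 0"
  "det3 a a c = 0" "det3 a b a = 0" "det3 a b b = 0"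
  by (simp_all add: det3_def)

lemma det3_cross: "det3 a b c = cross a b \<cdot> c" "det3 a b c = a \<cdot> cross b c"
  by (simp_all add: det3_def minor3_def scalar_product_3 algebra_simps)

lemma cross_orthogonal [simp]: "cross a b \<cdot> a = 0" "cross a b \<cdot> b = 0"
  by (simp_all add: scalar_product_3 algebra_simps)

text \<open>Cramer's rule expresses the multiple of \<open>x\<close> by the determinant in terms of the three scalar products.\<close>

lemma det3_kernel:
  assumes "det3 a b c \<noteq> 0" "x \<cdot> a = 0" "x \<cdot> b = 0" "x \<cdot> c = 0"
  shows "x = 0"
proof -
  have "det3 a b c *s x = (x \<cdot> a) *s cross b c + (x \<cdot> b) *s cross c a + (x \<cdot> c) *s cross a b"
    by (simp add: vec_eq_3 det3_def minor3_def scalar_product_3 algebra_simps)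
  with assms show ?thesis by simp
qed

lemma det3_eq_0:
  assumes "x \<noteq> 0" "x \<cdot> a = 0" "x \<cdot> b = 0" "x \<cdot> c = 0"
  shows "det3 a b c = 0"
  using assms det3_kernel[of a b c x] by metis

lemma det3_expand:
  "det3 a b c *s x = det3 x b c *s a + det3 a x c *s b + det3 a b x *s c"
  by (simp add: vec_eq_3 det3_def minor3_def algebra_simps)

text \<open>Cramer's rule, as in dimension three.\<close>

lemma det4_kernel:
  assumes "det4 a b c d \<noteq> 0" "x \<cdot> a = 0" "x \<cdot> b = 0" "x \<cdot> c = 0" "x \<cdot> d = 0"
  shows "x = 0"
proof -
  have "det4 a b c d *s x = (x \<cdot> a) *s cross4 b c d - (x \<cdot> b) *s cross4 a c d
      + (x \<cdot> c) *s cross4 a b d - (x \<cdot> d) *s cross4 a b c"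
    unfolding vec_eq_4 det4_def minor3_def scalar_product_4
      vector_add_component vector_minus_component vector_smult_component cross4_nth
    by (intro conjI) algebra+
  with assms show ?thesis by simp
qed

lemma cross4_linear [simp]:
  "cross4 (a + a') b c = cross4 a b c + cross4 a' b c"
  "cross4 a (b + b') c = cross4 a b c + cross4 a b' c"
  "cross4 a b (c + c') = cross4 a b c + cross4 a b c'"
  "cross4 a (b - b') c = cross4 a b c - cross4 a b' c"
  "cross4 (t *s a) b c = t *s cross4 a b c"
  "cross4 a (t *s b) c = t *s cross4 a b c"
  "cross4 a b (t *s c) = t *s cross4 a b c"
  "cross4 0 b c = 0" "cross4 a 0 c = 0" "cross4 a b 0 = 0"
  "cross4 a a c = 0" "cross4 a b a = 0" "cross4 a b b = 0"
  by (simp_all add: vec_eq_4 algebra_simps)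

lemma cross4_orthogonal [simp]:
  "a \<cdot> cross4 a b c = 0" "b \<cdot> cross4 a b c = 0" "c \<cdot> cross4 a b c = 0"
  by (simp_all add: scalar_product_4 minor3_def algebra_simps)

lemma det4_independent:
  assumes "det4 a b c d \<noteq> 0" "\<alpha> *s a + \<beta> *s b + \<gamma> *s c + \<delta> *s d = 0"
  shows "\<alpha> = 0 \<and> \<beta> = 0 \<and> \<gamma> = 0 \<and> \<delta> = 0"
proof -
  have swap: "det4 b a c d = - det4 a b c d" "det4 c b a d = - det4 a b c d"
    "det4 d b c a = - det4 a b c d" for a b c d
    unfolding det4_def scalar_product_4 cross4_nth minor3_def by algebra+
  have first: "\<alpha> * det4 a b c d = 0" if "\<alpha> *s a + \<beta> *s b + \<gamma> *s c + \<delta> *s d = 0"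
    for a b c d \<alpha> \<beta> \<gamma> \<delta>
  proof -
    have "(\<alpha> *s a + \<beta> *s b + \<gamma> *s c + \<delta> *s d) \<cdot> cross4 b c d = \<alpha> * det4 a b c d"
      by (simp add: det4_def)
    then show ?thesis by (simp add: that)
  qed
  have "\<alpha> * det4 a b c d = 0"
    using first[OF assms(2)] .
  moreover have "\<beta> * det4 b a c d = 0"
    by (rule first[of \<beta> b \<alpha> a \<gamma> c \<delta> d]) (use assms(2) in \<open>simp only: add_ac\<close>)
  moreover have "\<gamma> * det4 c b a d = 0"
    by (rule first[of \<gamma> c \<beta> b \<alpha> a \<delta> d]) (use assms(2) in \<open>simp only: add_ac\<close>)
  moreover have "\<delta> * det4 d b c a = 0"
    by (rule first[of \<delta> d \<beta> b \<gamma> c \<alpha> a]) (use assms(2) in \<open>simp only: add_ac\<close>)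
  ultimately show ?thesis using assms(1) by (simp add: swap[where a = a and b = b and c = c and d = d])
qed

text \<open>The right-hand side is the determinant of the matrix of scalar products, so this is the
  Cauchy--Binet formula.\<close>

lemma cross4_cauchy_binet:
  "cross4 h h' h'' \<cdot> cross4 p q r =
      (h \<cdot> p) * ((h' \<cdot> q) * (h'' \<cdot> r) - (h' \<cdot> r) * (h'' \<cdot> q))
    - (h \<cdot> q) * ((h' \<cdot> p) * (h'' \<cdot> r) - (h' \<cdot> r) * (h'' \<cdot> p))
    + (h \<cdot> r) * ((h' \<cdot> p) * (h'' \<cdot> q) - (h' \<cdot> q) * (h'' \<cdot> p))"
  unfolding scalar_product_4 cross4_nth minor3_def by algebra

text \<open>This is how planes are shown to be independent: it is enough to find three points such
  that the matrix of incidences is triangular.\<close>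

lemma cross4_triangular_nonzero:
  assumes "h' \<cdot> p = 0" "h'' \<cdot> p = 0" "h'' \<cdot> q = 0"
    and "h \<cdot> p \<noteq> 0" "h' \<cdot> q \<noteq> 0" "h'' \<cdot> r \<noteq> 0"
  shows "cross4 h h' h'' \<noteq> 0"
proof
  assume "cross4 h h' h'' = 0"
  then have "0 = (h \<cdot> p) * ((h' \<cdot> q) * (h'' \<cdot> r))"
    using cross4_cauchy_binet[of h h' h'' p q r] assms(1-3) by simp
  with assms(4-6) show False by simp
qed

lemma det4_linear [simp]:
  "det4 (a + a') b c d = det4 a b c d + det4 a' b c d"
  "det4 a (b + b') c d = det4 a b c d + det4 a b' c d"
  "det4 a b (c + c') d = det4 a b c d + det4 a b c' d"
  "det4 a b c (d + d') = det4 a b c d + det4 a b c d'"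
  "det4 (t *s a) b c d = t * det4 a b c d"
  "det4 a (t *s b) c d = t * det4 a b c d"
  "det4 a b (t *s c) d = t * det4 a b c d"
  "det4 a b c (t *s d) = t * det4 a b c d"
  by (simp_all add: det4_def)

lemma det4_alternating [simp]:
  "det4 a a c d = 0" "det4 a b a d = 0" "det4 a b c a = 0"
  "det4 a b b d = 0" "det4 a b c b = 0" "det4 a b c c = 0"
  by (simp_all add: det4_def)

lemma det4_swap_last: "det4 a b d c = - det4 a b c d"
  unfolding det4_def scalar_product_4 cross4_nth minor3_def by algebra

lemma cross4_dot_eq_det4: "cross4 a b c \<cdot> d = - det4 a b c d"
  unfolding det4_def scalar_product_4 cross4_nth minor3_def by algebra

lemma polynomial_fun_cross4 [polynomial_intros]:
  assumes "\<And>s. polynomial_fun crd (\<lambda>a. f a $ s)" "\<And>s. polynomial_fun crd (\<lambda>a. g a $ s)"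
    "\<And>s. polynomial_fun crd (\<lambda>a. h a $ s)"
  shows "polynomial_fun crd (\<lambda>a. cross4 (f a) (g a) (h a) $ s)"
proof -
  have "\<forall>s. polynomial_fun crd (\<lambda>a. cross4 (f a) (g a) (h a) $ s)"
    unfolding forall_4 by (auto simp: minor3_def intro!: polynomial_intros assms)
  then show ?thesis ..
qed

lemma polynomial_fun_det4 [polynomial_intros]:
  assumes "\<And>s. polynomial_fun crd (\<lambda>a. f a $ s)" "\<And>s. polynomial_fun crd (\<lambda>a. g a $ s)"
    "\<And>s. polynomial_fun crd (\<lambda>a. h a $ s)" "\<And>s. polynomial_fun crd (\<lambda>a. k a $ s)"
  shows "polynomial_fun crd (\<lambda>a. det4 (f a) (g a) (h a) (k a))"
  unfolding det4_def scalar_product_def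
  by (rule polynomial_fun_sum, rule polynomial_fun_mult) (rule assms polynomial_fun_cross4)+

section \<open>Projective points and lines\<close>

text \<open>Independence of an ordered pair. In contrast to independence of the set \<open>{u, v}\<close>, it excludes
  \<open>u = v\<close>.\<close>

definition indep2 :: "complex^'n \<Rightarrow> complex^'n \<Rightarrow> bool" where
  "indep2 u v \<longleftrightarrow> (\<forall>a b. a *s u + b *s v = 0 \<longrightarrow> a = 0 \<and> b = 0)"

definition span2 :: "complex^'n \<Rightarrow> complex^'n \<Rightarrow> (complex^'n) set" where
  "span2 u v = {a *s u + b *s v | a b. True}"

lemma span2_eq_span: "span2 u v = vec.span {u, v}"
  unfolding span2_def vec.span_insert vec.span_singleton
  by (auto simp: algebra_simps eq_diff_eq)

lemma indep2_iff: "indep2 u v \<longleftrightarrow> v \<noteq> 0 \<and> (\<forall>k. u \<noteq> k *s v)"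
proof
  assume *: "indep2 u v"
  have "v \<noteq> 0"
    using *[unfolded indep2_def, rule_format, of 0 1] by auto
  moreover have "u \<noteq> k *s v" for k
    using *[unfolded indep2_def, rule_format, of 1 "- k"] by auto
  ultimately show "v \<noteq> 0 \<and> (\<forall>k. u \<noteq> k *s v)" by blast
next
  assume *: "v \<noteq> 0 \<and> (\<forall>k. u \<noteq> k *s v)"
  have "a = 0 \<and> b = 0" if ab: "a *s u + b *s v = 0" for a b
  proof -
    have "a = 0"
    proof (rule ccontr)
      assume "a \<noteq> 0"
      have "u = (- b / a) *s v"
        using ab \<open>a \<noteq> 0\<close> by (simp add: vec_eq_iff field_simps add_eq_0_iff2)
      with * show False by blast
    qed
    with ab * show ?thesis by (auto simp: vec_eq_iff)
  qed
  then show "indep2 u v" unfolding indep2_def by blast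
qed

lemma indep2_iff_independent:
  "indep2 u v \<longleftrightarrow> u \<noteq> v \<and> vec.independent {u, v}"
proof (cases "u = v")
  case True
  then show ?thesis
    by (metis indep2_iff vector_smult_lid)
next
  case False
  then show ?thesis
    by (auto simp: indep2_iff vec.independent_insert vec.span_singleton)
qed

lemma grassmannian_2_iff:
  "L \<in> grassmannian 2 \<longleftrightarrow> (\<exists>u v. indep2 u v \<and> L = span2 u v)"
proof
  assume "L \<in> grassmannian 2"
  then have L: "vec.subspace L" "vec.dim L = 2" by (auto simp: grassmannian_def)
  obtain B where B: "B \<subseteq> L" "vec.independent B" "L \<subseteq> vec.span B" "card B = 2"
    using vec.basis_exists[of L] L(2) by metis
  obtain u v where "B = {u, v}" "u \<noteq> v" using B(4) by (auto simp: card_2_iff)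
  moreover have "L = vec.span B"
    using B L(1) by (simp add: vec.span_minimal subset_antisym)
  ultimately show "\<exists>u v. indep2 u v \<and> L = span2 u v"
    using B(2) by (auto simp: indep2_iff_independent span2_eq_span)
next
  assume "\<exists>u v. indep2 u v \<and> L = span2 u v"
  then show "L \<in> grassmannian 2"
    by (auto simp: indep2_iff_independent span2_eq_span grassmannian_def
        vec.dim_eq_card_independent)
qed

lemma grassmannian_1_iff:
  "L \<in> grassmannian 1 \<longleftrightarrow> (\<exists>u. u \<noteq> 0 \<and> L = range (\<lambda>a. a *s u))"
proof
  assume "L \<in> grassmannian 1"
  then have L: "vec.subspace L" "vec.dim L = 1" by (auto simp: grassmannian_def)
  obtain B where B: "B \<subseteq> L" "vec.independent B" "L \<subseteq> vec.span B" "card B = 1"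
    using vec.basis_exists[of L] L(2) by metis
  obtain u where "B = {u}" using B(4) by (auto simp: card_1_singleton_iff)
  moreover have "L = vec.span B"
    using B L(1) by (simp add: vec.span_minimal subset_antisym)
  ultimately show "\<exists>u. u \<noteq> 0 \<and> L = range (\<lambda>a. a *s u)"
    using B(2) by (auto simp: vec.span_singleton)
next
  assume "\<exists>u. u \<noteq> 0 \<and> L = range (\<lambda>a. a *s u)"
  then show "L \<in> grassmannian 1"
    by (auto simp: grassmannian_def simp flip: vec.span_singleton)
qed

lemma span2_subspace: "vec.subspace (span2 u v)"
  by (simp add: span2_eq_span)

lemma in_span2: "u \<in> span2 u v" "v \<in> span2 u v"
  by (simp_all add: span2_eq_span vec.span_base)

lemma grassmannian_subset_eq:
  assumes "L \<in> grassmannian k" "M \<in> grassmannian k" "L \<subseteq> M"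
  shows "L = M"
  using assms vec.subspace_dim_equal[of L M] by (simp add: grassmannian_def)

lemma projective_point_eqI:
  assumes "P \<in> grassmannian 1" "Q \<in> grassmannian 1" "x \<in> P" "x \<in> Q" "x \<noteq> 0"
  shows "P = Q"
proof -
  have "S = range (\<lambda>a. a *s x)" if S: "S \<in> grassmannian 1" "x \<in> S" for S
  proof -
    obtain u b where u: "S = range (\<lambda>a. a *s u)" "x = b *s u"
      using S unfolding grassmannian_1_iff by blast
    have "a *s u = (a / b) *s x" for a using u(2) assms(5) by auto
    moreover have "a *s x = (a * b) *s u" for a using u(2) by simp
    ultimately show ?thesis unfolding u(1) by blast
  qed
  from this[OF assms(1,3)] this[OF assms(2,4)] show ?thesis by simp
qed

lemma projective_point_nonzero:
  assumes "P \<in> grassmannian 1" shows "\<exists>x. x \<in> P \<and> x \<noteq> 0"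
proof -
  obtain u where "u \<noteq> 0" "P = range (\<lambda>a. a *s u)"
    using assms unfolding grassmannian_1_iff by blast
  moreover from this have "1 *s u \<in> P" by blast
  ultimately show ?thesis by (auto intro!: exI[of _ u])
qed

lemma forms_locus_scale: "x \<in> forms_locus n a \<Longrightarrow> t *s x \<in> forms_locus n a"
  by (simp add: forms_locus_def)

lemma projective_point_subset_locus:
  assumes "P \<in> grassmannian 1" "x \<in> P" "x \<noteq> 0" "x \<in> forms_locus n a"
  shows "P \<subseteq> forms_locus n a"
proof -
  have "range (\<lambda>a. a *s x) \<in> grassmannian 1"
    unfolding grassmannian_1_iff using assms(3) by blast
  moreover have "x \<in> range (\<lambda>a. a *s x)" by (rule range_eqI[of _ _ 1]) simp
  ultimately have "P = range (\<lambda>a. a *s x)"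
    using projective_point_eqI assms by blast
  then show ?thesis using assms(4) forms_locus_scale by blast
qed

text \<open>The point \<open>p\<close> shows that the planes \<open>h\<close> and \<open>h'\<close> are distinct. Adding \<open>p\<close> and a point that
  lies on \<open>h\<close> but not on \<open>h'\<close> to the intersection generates the space, and each
  raises the dimension by one.\<close>

lemma two_planes_meet_in_line:
  fixes h h' p :: "complex^4"
  assumes "h \<cdot> p \<noteq> 0" "h' \<cdot> p = 0" "h' \<noteq> 0"
  shows "{y. h \<cdot> y = 0 \<and> h' \<cdot> y = 0} \<in> grassmannian 2"
proof -
  let ?L = "{y. h \<cdot> y = 0 \<and> h' \<cdot> y = 0}"
  have L: "vec.subspace ?L"
    by (auto simp: vec.subspace_def)
  obtain q' where q': "h' \<cdot> q' \<noteq> 0" using scalar_product_nondegenerate[OF assms(3)] .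
  define q where "q = q' - (h \<cdot> q' / h \<cdot> p) *s p"
  have q: "h \<cdot> q = 0" "h' \<cdot> q \<noteq> 0"
    using q' assms by (simp_all add: q_def)
  have "p \<notin> vec.span ?L"
    using L assms(1) by (simp add: vec.span_eq_iff[THEN iffD2])
  moreover have "q \<notin> vec.span (insert p ?L)"
  proof
    assume "q \<in> vec.span (insert p ?L)"
    then obtain k where "q - k *s p \<in> vec.span ?L"
      unfolding vec.span_insert by blast
    then have "h' \<cdot> (q - k *s p) = 0"
      using L by (simp add: vec.span_eq_iff[THEN iffD2])
    with q(2) assms(2) show False by simp
  qed
  ultimately have "vec.dim (insert q (insert p ?L)) = vec.dim ?L + 2"
    by (simp add: vec.dim_insert)
  moreover have "x \<in> vec.span (insert q (insert p ?L))" for x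
  proof -
    have "x - (h' \<cdot> x / h' \<cdot> q) *s q - (h \<cdot> x / h \<cdot> p) *s p \<in> vec.span ?L"
      by (rule vec.span_base) (use assms q in simp)
    then show ?thesis unfolding vec.span_insert by blast
  qed
  then have "vec.span (insert q (insert p ?L)) = UNIV" by blast
  then have "vec.dim (insert q (insert p ?L)) = vec.dim (UNIV :: (complex^4) set)"
    using vec.dim_span[of "insert q (insert p ?L)"] by simp
  then have "vec.dim (insert q (insert p ?L)) = 4"
    unfolding vec_dim_card by simp
  ultimately show ?thesis
    using L by (simp add: grassmannian_def)
qed

text \<open>If the planes were independent, some fourth plane \<open>w\<close> would have no point in common with
  the three. But every plane meets the line through \<open>u\<close> and \<open>v\<close>, which lies on all three.\<close>

lemma planes_of_pencil_dependent:
  assumes "indep2 u v" "\<And>h. h \<in> {f, g, h'} \<Longrightarrow> h \<cdot> u = 0 \<and> h \<cdot> v = 0"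
  shows "cross4 f g h' = 0"
proof (rule ccontr)
  assume "cross4 f g h' \<noteq> 0"
  then obtain w where "cross4 f g h' \<cdot> w \<noteq> 0" by (rule scalar_product_nondegenerate)
  then have det: "det4 w f g h' \<noteq> 0" by (simp add: det4_def scalar_product_commute)
  have *: "y = 0" if "w \<cdot> y = 0" "y = a *s u + b *s v" for y a b
    by (rule det4_kernel[OF det]) (use that assms(2) in \<open>simp_all add: scalar_product_commute[of _ w]
      scalar_product_commute[of _ f] scalar_product_commute[of _ g] scalar_product_commute[of _ h']\<close>)
  have "(w \<cdot> v) *s u + (- (w \<cdot> u)) *s v = 0"
    by (rule *[of _ "w \<cdot> v" "- (w \<cdot> u)"]) (simp_all add: mult.commute)
  then have "w \<cdot> u = 0" "w \<cdot> v = 0"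
    using assms(1) unfolding indep2_def by (metis neg_equal_0_iff_equal)+
  then have "1 *s u + 0 *s v = 0" by (intro *[of _ 1 0]) simp_all
  with assms(1) show False unfolding indep2_def by (metis one_neq_zero)
qed

lemma cross_nonzero:
  assumes "indep2 x y" shows "cross x y \<noteq> 0"
proof
  assume 0: "cross x y = 0"
  obtain j where "y $ j \<noteq> 0" using assms by (auto simp: indep2_iff vec_eq_iff)
  have "x = (x $ j / y $ j) *s y"
    using 0 \<open>y $ j \<noteq> 0\<close> exhaust_3[of j] by (auto simp: vec_eq_3 field_simps)
  with assms show False by (auto simp: indep2_iff)
qed

lemma orthogonal_of_indep2:
  assumes "indep2 x y" "l \<cdot> x = 0" "l \<cdot> y = 0"
  shows "\<exists>a. l = a *s cross x y"
proof -
  obtain z where z: "cross x y \<cdot> z \<noteq> 0"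
    using cross_nonzero[OF assms(1)] by (rule scalar_product_nondegenerate)
  have "l - ((l \<cdot> z) / (cross x y \<cdot> z)) *s cross x y = 0"
    by (rule det3_kernel[of x y z]) (use z assms in \<open>simp_all add: det3_cross(1)\<close>)
  then have "l = ((l \<cdot> z) / (cross x y \<cdot> z)) *s cross x y" by simp
  then show ?thesis ..
qed

section \<open>Equations of the line multiview variety\<close>

text \<open>A trilinear form in the representatives on the factors \<open>i\<close>, \<open>j\<close>, \<open>k\<close> is a multihomogeneous
  polynomial. Its degree counts how often a factor occurs among the three.\<close>

lemma multiproj_closure_trilinear:
  fixes T :: "3 \<Rightarrow> 3 \<Rightarrow> 3 \<Rightarrow> complex" and p :: "'m \<Rightarrow> (complex^3) set"
  assumes p: "p \<in> multiproj_closure S"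
    and S: "\<And>q x. q \<in> S \<Longrightarrow> (\<And>l. x l \<in> q l \<and> x l \<noteq> 0) \<Longrightarrow>
      (\<Sum>a\<in>UNIV. \<Sum>b\<in>UNIV. \<Sum>c\<in>UNIV. T a b c * (x i $ a * x j $ b * x k $ c)) = 0"
    and x: "\<And>l. x l \<in> p l \<and> x l \<noteq> 0"
  shows "(\<Sum>a\<in>UNIV. \<Sum>b\<in>UNIV. \<Sum>c\<in>UNIV. T a b c * (x i $ a * x j $ b * x k $ c)) = 0"
proof -
  define mon where "mon a b c = Poly_Mapping.single (i, a) 1 + Poly_Mapping.single (j, b) 1
      + Poly_Mapping.single (k, c) (1 :: nat)" for a b c :: 3
  define f where "f = (\<Sum>a\<in>UNIV. \<Sum>b\<in>UNIV. \<Sum>c\<in>UNIV. Poly_Mapping.single (mon a b c) (T a b c))"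
  have eval: "cpoly_eval f (\<lambda>(l, s). x l $ s) =
      (\<Sum>a\<in>UNIV. \<Sum>b\<in>UNIV. \<Sum>c\<in>UNIV. T a b c * (x i $ a * x j $ b * x k $ c))" for x
    unfolding f_def cpoly_eval_sum cpoly_eval_single mon_def monomial_eval_add by simp
  define deg :: "'m \<Rightarrow> nat"
    where "deg = (\<lambda>l. of_bool (i = l) + of_bool (j = l) + of_bool (k = l))"
  have "multihomogeneous deg f"
    unfolding multihomogeneous_def
  proof (intro ballI allI)
    fix e and l :: 'm assume "e \<in> Poly_Mapping.keys f"
    then have "(\<Sum>a\<in>UNIV. \<Sum>b\<in>UNIV. \<Sum>c\<in>UNIV.
        Poly_Mapping.lookup (Poly_Mapping.single (mon a b c) (T a b c)) e) \<noteq> 0"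
      by (simp add: f_def in_keys_iff lookup_sum)
    then obtain a b c where "Poly_Mapping.lookup (Poly_Mapping.single (mon a b c) (T a b c)) e \<noteq> 0"
      by (meson sum.neutral)
    then have e: "e = mon a b c" by (auto simp: lookup_single when_def split: if_splits)
    have single: "(\<Sum>s\<in>UNIV. Poly_Mapping.lookup (Poly_Mapping.single (l', a') (1 :: nat)) (l, s))
        = of_bool (l' = l)" for l' :: 'm and a' :: 3
      by (simp add: lookup_single when_def)
    show "(\<Sum>s\<in>UNIV. Poly_Mapping.lookup e (l, s)) = deg l"
      unfolding e mon_def lookup_add sum.distrib single deg_def ..
  qed
  moreover have "vanishes_at f q" if "q \<in> S" for q
    using S[OF that] by (simp add: vanishes_at_def eval)
  ultimately have "vanishes_at f p"
    using p unfolding multiproj_closure_def by blast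
  with x show ?thesis by (simp add: vanishes_at_def eval)
qed

text \<open>The plane of the points whose images lie on the image line \<open>x\<close>. As a covector it is the
  combination of the rows of the camera with coefficients \<open>x\<close>.\<close>

definition back_projection :: "complex^4^3 \<Rightarrow> complex^3 \<Rightarrow> complex^4" where
  "back_projection C x = x$1 *s C$1 + x$2 *s C$2 + x$3 *s C$3"

lemma back_projection: "back_projection C x \<cdot> y = x \<cdot> (C *v y)"
  unfolding back_projection_def scalar_product_matrix_vector ..

lemma cross4_back_projection:
  "cross4 (back_projection C x) (back_projection C' y) (back_projection C'' z) $ s =
    (\<Sum>a\<in>UNIV. \<Sum>b\<in>UNIV. \<Sum>c\<in>UNIV. cross4 (C$a) (C'$b) (C''$c) $ s * (x$a * y$b * z$c))"
  by (simp add: back_projection_def sum_3 algebra_simps)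

lemma camera_line_iff: "l \<in> camera_line C L \<longleftrightarrow> (\<forall>y\<in>L. l \<cdot> (C *v y) = 0)"
  by (simp add: camera_line_def line_equation_def scalar_product_commute[of _ l])

text \<open>On the image of a line \<open>L\<close> the three planes contain \<open>L\<close> and are dependent. The components
  of the triple cross product are trilinear in the image lines, so the dependence
  persists on the closure.\<close>

lemma line_multiview_variety_rank:
  assumes p: "p \<in> line_multiview_variety C" and x: "\<And>l. x l \<in> p l \<and> x l \<noteq> 0"
  shows "cross4 (back_projection (C i) (x i)) (back_projection (C j) (x j))
    (back_projection (C k) (x k)) = 0"
proof -
  have "cross4 (back_projection (C i) (x i)) (back_projection (C j) (x j))
      (back_projection (C k) (x k)) $ s = 0" for s
    unfolding cross4_back_projection
  proof (rule multiproj_closure_trilinear[OF p[unfolded line_multiview_variety_def] _ x])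
    fix q x assume "q \<in> joint_camera_map C ` joint_camera_domain C"
      and x: "\<And>l. x l \<in> q l \<and> x l \<noteq> 0"
    then obtain L where L: "L \<in> grassmannian 2" "q = joint_camera_map C L"
      by (auto simp: joint_camera_domain_def)
    then obtain u v where uv: "indep2 u v" "L = span2 u v"
      unfolding grassmannian_2_iff by blast
    have "back_projection (C l) (x l) \<cdot> y = 0" if "y \<in> L" for l y
      using x[of l] that by (simp add: L(2) joint_camera_map_def camera_line_iff back_projection)
    then have "cross4 (back_projection (C i) (x i)) (back_projection (C j) (x j))
        (back_projection (C k) (x k)) = 0"
      by (intro planes_of_pencil_dependent[OF uv(1)]) (auto simp: uv(2) in_span2)
    then show "(\<Sum>a\<in>UNIV. \<Sum>b\<in>UNIV. \<Sum>c\<in>UNIV.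
        cross4 (C i$a) (C j$b) (C k$c) $ s * (x i $ a * x j $ b * x k $ c)) = 0"
      by (simp flip: cross4_back_projection)
  qed
  then show ?thesis by (simp add: vec_eq_iff)
qed

section \<open>Linear forms with prescribed values and a pair of bilinear equations\<close>

lemma ex_linear_forms:
  fixes f :: "'m \<Rightarrow> nat \<Rightarrow> complex^3"
  shows "\<exists>A\<in>linear_forms d. \<forall>i k. k < d i \<longrightarrow> A i k = f i k"
  by (rule bexI[of _ "\<lambda>i k. if k < d i then f i k else 0"]) (auto simp: linear_forms_def)

lemma linear_forms_nonempty: "linear_forms d \<noteq> {}"
proof -
  have "(\<lambda>i k. 0) \<in> linear_forms d" by (simp add: linear_forms_def)
  then show ?thesis by auto
qed

lemma ex_det3_nonzero:
  assumes "z \<noteq> 0" shows "\<exists>a b. det3 a b z \<noteq> 0"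
proof (rule ccontr)
  assume "\<nexists>a b. det3 a b z \<noteq> 0"
  then have "det3 (axis 2 1) (axis 3 1) z = 0" "det3 (axis 3 1) (axis 1 1) z = 0"
    "det3 (axis 1 1) (axis 2 1) z = 0" by blast+
  then have "z = 0" by (simp add: vec_eq_3 det3_def minor3_def axis_def)
  with assms show False ..
qed

text \<open>Eliminating \<open>t\<close> leaves a quadratic equation in \<open>s\<close> with the discriminant in the third
  hypothesis. Without a common component, two such equations have two solutions on the product of two
  projective lines, with multiplicity. The first two hypotheses say that none of them has \<open>s = \<infinity>\<close> or \<open>t = \<infinity>\<close>.\<close>

lemma two_bilinear_equations:
  fixes \<alpha>0 \<alpha>1 \<alpha>2 \<alpha>3 \<beta>0 \<beta>1 \<beta>2 \<beta>3 :: complex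
  assumes s_inf: "\<alpha>1 * \<beta>3 - \<beta>1 * \<alpha>3 \<noteq> 0"
    and t_inf: "\<alpha>2 * \<beta>3 - \<beta>2 * \<alpha>3 \<noteq> 0"
    and disc: "(\<alpha>0 * \<beta>3 + \<alpha>1 * \<beta>2 - \<beta>0 * \<alpha>3 - \<beta>1 * \<alpha>2)\<^sup>2
      - 4 * (\<alpha>1 * \<beta>3 - \<beta>1 * \<alpha>3) * (\<alpha>0 * \<beta>2 - \<beta>0 * \<alpha>2) \<noteq> 0"
  shows "card {(s, t). \<alpha>0 + \<alpha>1 * s + \<alpha>2 * t + \<alpha>3 * s * t = 0
    \<and> \<beta>0 + \<beta>1 * s + \<beta>2 * t + \<beta>3 * s * t = 0} = 2" (is "card ?S = 2")
proof -
  define q2 q1 q0 where "q2 = \<alpha>1 * \<beta>3 - \<beta>1 * \<alpha>3"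
    and "q1 = \<alpha>0 * \<beta>3 + \<alpha>1 * \<beta>2 - \<beta>0 * \<alpha>3 - \<beta>1 * \<alpha>2"
    and "q0 = \<alpha>0 * \<beta>2 - \<beta>0 * \<alpha>2"
  note q_defs = q2_def q1_def q0_def
  have q2: "q2 \<noteq> 0" using s_inf by (simp add: q2_def)
  define w where "w = csqrt (q1\<^sup>2 - 4 * q2 * q0)"
  have w2: "w\<^sup>2 = q1\<^sup>2 - 4 * q2 * q0" by (simp add: w_def)
  have w: "w \<noteq> 0" using disc unfolding w_def q_defs by simp
  define s1 s2 where "s1 = (- q1 + w) / (2 * q2)" and "s2 = (- q1 - w) / (2 * q2)"
  have "s1 \<noteq> s2" using w q2 by (simp add: s1_def s2_def divide_simps)
  have sum: "q2 * (s1 + s2) = - q1" using q2 by (simp add: s1_def s2_def field_simps)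
  have "4 * q2 * (q2 * (s1 * s2)) = q1\<^sup>2 - w\<^sup>2"
    using q2 by (simp add: s1_def s2_def field_simps power2_eq_square)
  then have prod: "q2 * (s1 * s2) = q0" using q2 by (simp add: w2)
  have factor: "q2 * s\<^sup>2 + q1 * s + q0 = q2 * ((s - s1) * (s - s2))" for s
    using sum prod by (simp add: algebra_simps power2_eq_square) algebra
  have roots: "q2 * s\<^sup>2 + q1 * s + q0 = 0 \<longleftrightarrow> s \<in> {s1, s2}" for s
    unfolding factor using q2 by simp
  have eliminant: "(\<alpha>0 + \<alpha>1 * s) * (\<beta>2 + \<beta>3 * s) - (\<beta>0 + \<beta>1 * s) * (\<alpha>2 + \<alpha>3 * s)
      = q2 * s\<^sup>2 + q1 * s + q0" for s
    unfolding q_defs by algebra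
  \<comment> \<open>A common zero of the two coefficients of \<open>t\<close> would be a solution at \<open>t = \<infinity>\<close>.\<close>
  have unique: "\<alpha>2 + \<alpha>3 * s \<noteq> 0 \<or> \<beta>2 + \<beta>3 * s \<noteq> 0" for s
  proof (rule ccontr)
    assume "\<not> (\<alpha>2 + \<alpha>3 * s \<noteq> 0 \<or> \<beta>2 + \<beta>3 * s \<noteq> 0)"
    then have "\<alpha>2 * \<beta>3 - \<beta>2 * \<alpha>3 = 0" by algebra
    with t_inf show False ..
  qed
  have S: "(s, t) \<in> ?S \<longleftrightarrow> (\<alpha>0 + \<alpha>1 * s) + (\<alpha>2 + \<alpha>3 * s) * t = 0
      \<and> (\<beta>0 + \<beta>1 * s) + (\<beta>2 + \<beta>3 * s) * t = 0" for s t
    by (simp add: algebra_simps)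
  have "bij_betw fst ?S {s1, s2}"
    unfolding bij_betw_def
  proof
    show "inj_on fst ?S"
    proof (rule inj_onI)
      fix P Q assume P: "P \<in> ?S" and Q: "Q \<in> ?S" and eq: "fst P = fst Q"
      obtain s t t' where st: "P = (s, t)" "Q = (s, t')" using eq by (metis prod.collapse)
      have "(\<alpha>2 + \<alpha>3 * s) * (t - t') = 0" "(\<beta>2 + \<beta>3 * s) * (t - t') = 0"
        using P Q unfolding st S by algebra+
      then show "P = Q" using unique[of s] st by auto
    qed
    show "fst ` ?S = {s1, s2}"
    proof (intro set_eqI iffI)
      fix s assume "s \<in> fst ` ?S"
      then obtain t where "(s, t) \<in> ?S" by force
      then have "q2 * s\<^sup>2 + q1 * s + q0 = 0"
        unfolding S eliminant[symmetric] by algebra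
      then show "s \<in> {s1, s2}" by (simp add: roots)
    next
      fix s assume "s \<in> {s1, s2}"
      then have 0: "(\<alpha>0 + \<alpha>1 * s) * (\<beta>2 + \<beta>3 * s) - (\<beta>0 + \<beta>1 * s) * (\<alpha>2 + \<alpha>3 * s) = 0"
        unfolding eliminant roots .
      have "\<exists>t. (s, t) \<in> ?S"
        using unique[of s]
      proof
        assume ne: "\<alpha>2 + \<alpha>3 * s \<noteq> 0"
        define t where "t = - (\<alpha>0 + \<alpha>1 * s) / (\<alpha>2 + \<alpha>3 * s)"
        have 1: "(\<alpha>0 + \<alpha>1 * s) + (\<alpha>2 + \<alpha>3 * s) * t = 0" using ne by (simp add: t_def)
        have "(\<alpha>2 + \<alpha>3 * s) * ((\<beta>0 + \<beta>1 * s) + (\<beta>2 + \<beta>3 * s) * t) = 0"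
          using 0 1 by algebra
        then show ?thesis unfolding S using 1 ne by auto
      next
        assume ne: "\<beta>2 + \<beta>3 * s \<noteq> 0"
        define t where "t = - (\<beta>0 + \<beta>1 * s) / (\<beta>2 + \<beta>3 * s)"
        have 1: "(\<beta>0 + \<beta>1 * s) + (\<beta>2 + \<beta>3 * s) * t = 0" using ne by (simp add: t_def)
        have "(\<beta>2 + \<beta>3 * s) * ((\<alpha>0 + \<alpha>1 * s) + (\<alpha>2 + \<alpha>3 * s) * t) = 0"
          using 0 1 by algebra
        then show ?thesis unfolding S using 1 ne by auto
      qed
      then show "s \<in> fst ` ?S" by force
    qed
  qed
  then show ?thesis using \<open>s1 \<noteq> s2\<close> by (simp add: bij_betw_same_card)
qed

lemma det3_rotate: "det3 b c a = det3 a b c"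
  by (simp add: det3_def minor3_def algebra_simps)

lemma card_1_if_unique:
  assumes "a \<in> S" "\<And>x. x \<in> S \<Longrightarrow> x = a"
  shows "card S = 1"
proof -
  have "S = {a}" using assms by blast
  then show ?thesis by simp
qed

section \<open>Lines in space and points of a linear section\<close>

text \<open>All later arguments use the cameras through these properties: \<open>c i\<close> spans the center, \<open>R i\<close>
  lifts a point of the image plane to a point of its ray, and a determinant in an image plane
  is a determinant in space whose first vector is \<open>c i\<close>. Any four centers are independent.
  The conditions on two and three centers carry the same information when there
  are fewer than four cameras.\<close>

locale camera_arrangement =
  fixes C :: "'m::finite \<Rightarrow> complex^4^3" and c :: "'m \<Rightarrow> complex^4" and R :: "'m \<Rightarrow> complex^3^4"
  assumes right_inverse [simp]: "C i *v (R i *v a) = a"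
    and kernel: "C i *v x = 0 \<longleftrightarrow> (\<exists>t. x = t *s c i)"
    and det3_image: "det3 (C i *v x) (C i *v y) (C i *v z) = det4 (c i) x y z"
    and two_centers: "i \<noteq> j \<Longrightarrow> C i *v c j \<noteq> 0"
    and three_centers: "distinct [i, j, k] \<Longrightarrow> \<exists>e. det4 (c i) (c j) (c k) e \<noteq> 0"
    and four_centers: "distinct [i, j, k, l] \<Longrightarrow> det4 (c i) (c j) (c k) (c l) \<noteq> 0"
begin

lemma image_center [simp]: "C i *v c i = 0"
  unfolding kernel by (rule exI[of _ 1]) simp

lemma back_projection_nonzero:
  assumes "x \<noteq> 0" shows "back_projection (C i) x \<noteq> 0"
proof
  assume *: "back_projection (C i) x = 0"
  obtain y where "x \<cdot> y \<noteq> 0" using assms by (rule scalar_product_nondegenerate)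
  moreover have "x \<cdot> y = back_projection (C i) x \<cdot> (R i *v y)"
    by (simp add: back_projection)
  ultimately show False by (simp add: *)
qed

lemma pencil_line:
  assumes "x i \<noteq> 0" "x j \<noteq> 0" "x i \<cdot> (C i *v c j) \<noteq> 0"
  shows "{y. x i \<cdot> (C i *v y) = 0 \<and> x j \<cdot> (C j *v y) = 0} \<in> grassmannian 2"
proof -
  have "{y. back_projection (C i) (x i) \<cdot> y = 0 \<and> back_projection (C j) (x j) \<cdot> y = 0}
      \<in> grassmannian 2"
    by (rule two_planes_meet_in_line[of _ "c j"])
       (use assms back_projection_nonzero in \<open>simp_all add: back_projection\<close>)
  then show ?thesis unfolding back_projection .
qed

text \<open>If \<open>y\<close> were not on the plane of \<open>k\<close>, the incidences of the planes of \<open>k\<close>, \<open>j\<close>, \<open>i\<close> with \<open>y\<close>, a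
  point on the plane of \<open>i\<close> but not of \<open>j\<close>, and \<open>c j\<close> would form a triangular matrix, so the planes
  would be independent.\<close>

lemma line_through_variety_point:
  assumes p: "p \<in> line_multiview_variety C" and x: "\<And>l. x l \<in> p l \<and> x l \<noteq> 0"
    and ij: "x i \<cdot> (C i *v c j) \<noteq> 0"
    and y: "x i \<cdot> (C i *v y) = 0" "x j \<cdot> (C j *v y) = 0"
  shows "x k \<cdot> (C k *v y) = 0"
proof (rule ccontr)
  let ?h = "\<lambda>l. back_projection (C l) (x l)"
  assume k: "x k \<cdot> (C k *v y) \<noteq> 0"
  obtain q' where q': "?h j \<cdot> q' \<noteq> 0"
    using scalar_product_nondegenerate[OF back_projection_nonzero] x by metis
  define q where "q = q' - (?h i \<cdot> q' / ?h i \<cdot> c j) *s c j"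
  have hc: "?h j \<cdot> c j = 0" "?h i \<cdot> c j \<noteq> 0" using ij by (simp_all add: back_projection)
  have q: "?h i \<cdot> q = 0" "?h j \<cdot> q \<noteq> 0"
    using q' hc by (simp_all add: q_def)
  have "cross4 (?h k) (?h j) (?h i) \<noteq> 0"
    by (rule cross4_triangular_nonzero[where p = y and q = q and r = "c j"])
       (use k y q hc in \<open>simp_all add: back_projection\<close>)
  with line_multiview_variety_rank[OF p x] show False by blast
qed

lemma center_subset_iff:
  assumes "L \<in> grassmannian k"
  shows "center (C i) \<subseteq> L \<longleftrightarrow> c i \<in> L"
proof
  assume "center (C i) \<subseteq> L"
  then show "c i \<in> L" by (auto simp: center_def)
next
  assume "c i \<in> L"
  then show "center (C i) \<subseteq> L"
    using assms by (auto simp: center_def kernel grassmannian_def vec.subspace_scale)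
qed

text \<open>A camera is injective on a subspace that does not contain its center.\<close>

lemma images_indep2:
  assumes "indep2 u v" "c i \<notin> span2 u v"
  shows "indep2 (C i *v u) (C i *v v)"
  unfolding indep2_def
proof (intro allI impI)
  fix a b assume "a *s (C i *v u) + b *s (C i *v v) = 0"
  then have "C i *v (a *s u + b *s v) = 0"
    by (simp add: matrix_vector_right_distrib vec.scale)
  then obtain t where t: "a *s u + b *s v = t *s c i"
    unfolding kernel by blast
  have "t = 0"
  proof (rule ccontr)
    assume "t \<noteq> 0"
    have "c i = (1 / t) *s (a *s u + b *s v)"
      unfolding t using \<open>t \<noteq> 0\<close> by simp
    also have "\<dots> \<in> span2 u v"
      by (intro vec.subspace_scale[OF span2_subspace]) (auto simp: span2_def)
    finally show False using assms(2) by blast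
  qed
  with t assms(1) show "a = 0 \<and> b = 0" unfolding indep2_def by simp
qed

lemma camera_line_grassmannian:
  assumes "L \<in> grassmannian 2" "c i \<notin> L"
  shows "camera_line (C i) L \<in> grassmannian 1"
proof -
  obtain u v where uv: "indep2 u v" "L = span2 u v"
    using assms(1) unfolding grassmannian_2_iff by blast
  have indep: "indep2 (C i *v u) (C i *v v)"
    using images_indep2 uv assms(2) by blast
  have "camera_line (C i) L = range (\<lambda>a. a *s cross (C i *v u) (C i *v v))"
  proof (intro set_eqI iffI)
    fix l assume "l \<in> camera_line (C i) L"
    then have "l \<cdot> (C i *v u) = 0" "l \<cdot> (C i *v v) = 0"
      by (simp_all add: camera_line_iff uv(2) in_span2)
    then show "l \<in> range (\<lambda>a. a *s cross (C i *v u) (C i *v v))"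
      using orthogonal_of_indep2[OF indep] by blast
  next
    fix l assume "l \<in> range (\<lambda>a. a *s cross (C i *v u) (C i *v v))"
    then show "l \<in> camera_line (C i) L"
      by (auto simp: camera_line_iff uv(2) span2_def matrix_vector_right_distrib vec.scale)
  qed
  then show ?thesis
    unfolding grassmannian_1_iff using cross_nonzero[OF indep] by blast
qed

text \<open>The lines in space with, in each image, an image line through them that satisfies the
  forms. For a line that avoids the centers there is only one candidate for \<open>x\<close>, up to scaling. The existential
  form also makes sense for lines through centers, and it is what a point of
  the variety provides before it is known that its line avoids the centers.\<close>

definition incident_lines ::
    "('m \<Rightarrow> nat) \<Rightarrow> ('m \<Rightarrow> nat \<Rightarrow> complex^3) \<Rightarrow> (complex^4) set set" where
  "incident_lines d A = {L \<in> grassmannian 2.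
     \<forall>i. \<exists>x. x \<noteq> 0 \<and> x \<in> forms_locus (d i) (A i) \<and> (\<forall>y\<in>L. x \<cdot> (C i *v y) = 0)}"

text \<open>The hypothesis \<open>separate\<close> yields, for every point of the section, a center \<open>c j\<close> off the
  plane of camera \<open>i\<close>. Since the plane of camera \<open>j\<close> passes through \<open>c j\<close>, the two planes are
  distinct and the line of the point is their intersection.\<close>

lemma joint_camera_map_bij:
  assumes avoid: "\<And>L i. L \<in> incident_lines d A \<Longrightarrow> c i \<notin> L"
    and separate: "\<And>x. (\<And>i. x i \<noteq> 0 \<and> x i \<in> forms_locus (d i) (A i)) \<Longrightarrow>
      \<exists>i j. x i \<cdot> (C i *v c j) \<noteq> 0"
  shows "bij_betw (joint_camera_map C) (incident_lines d A)
    (linear_section (line_multiview_variety C) d A)"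
proof -
  have gr1: "joint_camera_map C L i \<in> grassmannian 1" if "L \<in> incident_lines d A" for L i
    unfolding joint_camera_map_def using that avoid
    by (intro camera_line_grassmannian) (auto simp: incident_lines_def)
  have locus: "joint_camera_map C L i \<subseteq> forms_locus (d i) (A i)"
    if L: "L \<in> incident_lines d A" for L i
  proof -
    obtain x where "x \<noteq> 0" "x \<in> forms_locus (d i) (A i)" "\<forall>y\<in>L. x \<cdot> (C i *v y) = 0"
      using L unfolding incident_lines_def by blast
    then show ?thesis
      using gr1[OF L, of i] by (intro projective_point_subset_locus[of _ x])
        (simp_all add: joint_camera_map_def camera_line_iff)
  qed
  have "joint_camera_map C L \<in> linear_section (line_multiview_variety C) d A"
    if L: "L \<in> incident_lines d A" for L
  proof -
    have "L \<in> joint_camera_domain C"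
      using L avoid[OF L] center_subset_iff[of L 2]
      by (auto simp: joint_camera_domain_def incident_lines_def)
    then have "joint_camera_map C L \<in> line_multiview_variety C"
      using gr1[OF L] unfolding line_multiview_variety_def multiproj_closure_def by blast
    with locus[OF L] show ?thesis by (simp add: linear_section_def)
  qed
  moreover have "\<exists>L\<in>incident_lines d A. p = joint_camera_map C L"
    if p: "p \<in> linear_section (line_multiview_variety C) d A" for p
  proof -
    have pV: "p \<in> line_multiview_variety C" and pL: "\<And>i. p i \<subseteq> forms_locus (d i) (A i)"
      using p by (auto simp: linear_section_def)
    then have p1: "p i \<in> grassmannian 1" for i
      by (simp add: line_multiview_variety_def multiproj_closure_def)
    obtain x where x: "\<And>i. x i \<in> p i \<and> x i \<noteq> 0"
      using projective_point_nonzero[OF p1] by metis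
    have xl: "x i \<in> forms_locus (d i) (A i)" for i using x pL by blast
    obtain i j where ij: "x i \<cdot> (C i *v c j) \<noteq> 0" using separate x xl by blast
    define L where "L = {y. x i \<cdot> (C i *v y) = 0 \<and> x j \<cdot> (C j *v y) = 0}"
    have L2: "L \<in> grassmannian 2"
      unfolding L_def using x ij by (intro pencil_line) auto
    have Lx: "x k \<cdot> (C k *v y) = 0" if "y \<in> L" for k y
      using line_through_variety_point[OF pV x ij] that by (simp add: L_def)
    have L: "L \<in> incident_lines d A"
      using L2 Lx x xl unfolding incident_lines_def by blast
    have "p = joint_camera_map C L"
    proof
      fix k show "p k = joint_camera_map C L k"
        by (rule projective_point_eqI[OF p1 gr1[OF L], of "x k"])
           (use x Lx in \<open>auto simp: joint_camera_map_def camera_line_iff\<close>)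
    qed
    with L show ?thesis by blast
  qed
  moreover have "inj_on (joint_camera_map C) (incident_lines d A)"
  proof (rule inj_onI)
    fix L M assume L: "L \<in> incident_lines d A" and M: "M \<in> incident_lines d A"
      and eq: "joint_camera_map C L = joint_camera_map C M"
    obtain x where x: "\<And>i. x i \<in> joint_camera_map C L i \<and> x i \<noteq> 0"
      using projective_point_nonzero[OF gr1[OF L]] by metis
    obtain i j where ij: "x i \<cdot> (C i *v c j) \<noteq> 0"
      using separate x locus[OF L] by blast
    let ?P = "{y. x i \<cdot> (C i *v y) = 0 \<and> x j \<cdot> (C j *v y) = 0}"
    have "?P \<in> grassmannian 2" using x ij by (intro pencil_line) auto
    moreover have "L \<subseteq> ?P"
      using x by (auto simp: joint_camera_map_def camera_line_iff)
    moreover have "M \<subseteq> ?P"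
      using x unfolding eq by (auto simp: joint_camera_map_def camera_line_iff)
    moreover have "L \<in> grassmannian 2" "M \<in> grassmannian 2"
      using L M by (auto simp: incident_lines_def)
    ultimately show "L = M"
      using grassmannian_subset_eq[of L 2 ?P] grassmannian_subset_eq[of M 2 ?P] by simp
  qed
  ultimately show ?thesis unfolding bij_betw_def by (auto simp: image_iff)
qed

lemma center_nonzero:
  assumes "i \<noteq> j" shows "c j \<noteq> 0"
  using two_centers[OF assms] by auto

text \<open>The left-hand side vanishes iff the line through \<open>y\<close> and \<open>z\<close> meets the ray of \<open>a\<close>, the
  right-hand side iff its image passes through \<open>a\<close>.\<close>

lemma det4_lift: "det4 (c i) (R i *v a) y z = det3 a (C i *v y) (C i *v z)"
  using det3_image[of i "R i *v a" y z] by simp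

lemma det4_lift2: "det4 (c i) (R i *v a) (R i *v b) z = det3 a b (C i *v z)"
  by (simp add: det4_lift)

lemma det4_lift_image [simp]: "det4 (c i) (R i *v (C i *v x)) y z = det4 (c i) x y z"
  by (simp add: det4_lift det3_image)

text \<open>A point and the lift of its image lie on the same ray.\<close>

lemma lift_image: "\<exists>t. R i *v (C i *v x) = x + t *s c i"
proof -
  have "C i *v (R i *v (C i *v x) - x) = 0"
    by (simp add: vec.diff)
  then obtain t where "R i *v (C i *v x) - x = t *s c i" unfolding kernel by blast
  then show ?thesis by (auto simp: algebra_simps)
qed

lemma det4_lift_image2 [simp]: "det4 (c i) y (R i *v (C i *v x)) z = det4 (c i) y x z"
proof -
  obtain t where "R i *v (C i *v x) = x + t *s c i" using lift_image by blast
  then show ?thesis by simp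
qed

text \<open>An incident line meets the rays of all forms.\<close>

lemma incident_line_det4:
  assumes "L \<in> incident_lines d A" "k < d i" "y \<in> L" "z \<in> L"
  shows "det4 (c i) (R i *v A i k) y z = 0"
proof -
  obtain x where x: "x \<noteq> 0" "x \<in> forms_locus (d i) (A i)" "\<forall>y\<in>L. x \<cdot> (C i *v y) = 0"
    using assms(1) unfolding incident_lines_def by blast
  have "det3 (A i k) (C i *v y) (C i *v z) = 0"
    by (rule det3_eq_0[OF x(1)])
       (use x assms in \<open>simp_all add: forms_locus_def scalar_product_commute[of x "A i k"]\<close>)
  then show ?thesis by (simp flip: det3_image)
qed

lemma plane_det4_nonzero:
  assumes "det4 (c i) (R i *v A i k) (R i *v A i k') y \<noteq> 0"
    and "k < d i" "k' < d i" "x \<noteq> 0" "x \<in> forms_locus (d i) (A i)"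
  shows "x \<cdot> (C i *v y) \<noteq> 0"
proof
  assume "x \<cdot> (C i *v y) = 0"
  then have "det3 (A i k) (A i k') (C i *v y) = 0"
    by (intro det3_eq_0[OF assms(4)])
       (use assms in \<open>simp_all add: forms_locus_def scalar_product_commute[of x "A i _"]\<close>)
  with assms(1) show False by (simp flip: det3_image)
qed

text \<open>With two forms on the same factor, an incident line lies in the plane of the two rays.\<close>

lemma incident_line_in_plane:
  assumes "L \<in> incident_lines d A" "k < d i" "k' < d i" "y \<in> L"
  shows "det4 (c i) (R i *v A i k) (R i *v A i k') y = 0"
proof (rule ccontr)
  assume "\<not> ?thesis"
  moreover obtain x where "x \<noteq> 0" "x \<in> forms_locus (d i) (A i)" "\<forall>y\<in>L. x \<cdot> (C i *v y) = 0"
    using assms(1) unfolding incident_lines_def by blast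
  ultimately show False using plane_det4_nonzero assms by blast
qed

text \<open>The image line of a line that avoids the center is the cross product of two image points.
  It satisfies the forms if the line meets their rays.\<close>

lemma span2_incident_lines:
  assumes "indep2 y z" "\<And>i. c i \<notin> span2 y z"
    and "\<And>i k. k < d i \<Longrightarrow> det4 (c i) (R i *v A i k) y z = 0"
  shows "span2 y z \<in> incident_lines d A"
proof -
  have "\<exists>x. x \<noteq> 0 \<and> x \<in> forms_locus (d i) (A i) \<and> (\<forall>w\<in>span2 y z. x \<cdot> (C i *v w) = 0)" for i
  proof (intro exI[of _ "cross (C i *v y) (C i *v z)"] conjI ballI)
    show "cross (C i *v y) (C i *v z) \<noteq> 0"
      by (rule cross_nonzero[OF images_indep2[OF assms(1,2)]])
    have "A i k \<cdot> cross (C i *v y) (C i *v z) = 0" if "k < d i" for k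
    proof -
      have "det3 (A i k) (C i *v y) (C i *v z) = det4 (c i) (R i *v A i k) y z"
        by (simp flip: det3_image)
      then show ?thesis using assms(3)[OF that] by (simp add: det3_cross(2))
    qed
    then show "cross (C i *v y) (C i *v z) \<in> forms_locus (d i) (A i)"
      by (simp add: forms_locus_def)
  next
    fix w assume "w \<in> span2 y z"
    then show "cross (C i *v y) (C i *v z) \<cdot> (C i *v w) = 0"
      by (auto simp: span2_def matrix_vector_right_distrib vec.scale)
  qed
  then show ?thesis
    using assms(1) unfolding incident_lines_def grassmannian_2_iff by blast
qed

text \<open>If the center is not on the line, the image of the line is a line through the image point
  \<open>A i 0\<close>, so some point of the line is mapped to \<open>A i 0\<close>.\<close>

lemma incident_line_meets_ray:
  assumes "L \<in> incident_lines d A" "0 < d i" "c i \<notin> L"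
  shows "\<exists>t. R i *v A i 0 + t *s c i \<in> L"
proof -
  have "L \<in> grassmannian 2" using assms(1) by (simp add: incident_lines_def)
  then obtain u v where uv: "indep2 u v" "L = span2 u v"
    unfolding grassmannian_2_iff by blast
  have indep: "indep2 (C i *v u) (C i *v v)"
    using images_indep2 uv assms(3) by blast
  obtain z where z: "cross (C i *v u) (C i *v v) \<cdot> z \<noteq> 0"
    using cross_nonzero[OF indep] by (rule scalar_product_nondegenerate)
  let ?D = "det3 (C i *v u) (C i *v v) z"
  have D: "?D \<noteq> 0" using z by (simp add: det3_cross(1))
  have "det3 (C i *v u) (C i *v v) (A i 0) = 0"
    using incident_line_det4[OF assms(1,2), of u v]
    by (simp add: uv(2) in_span2 det3_rotate[of "C i *v u" _ "A i 0"] flip: det3_image)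
  then have "?D *s A i 0 = det3 (A i 0) (C i *v v) z *s (C i *v u)
      + det3 (C i *v u) (A i 0) z *s (C i *v v)"
    using det3_expand[of "C i *v u" "C i *v v" z "A i 0"] by simp
  then have "(1 / ?D) *s (?D *s A i 0) = (1 / ?D) *s (det3 (A i 0) (C i *v v) z *s (C i *v u)
      + det3 (C i *v u) (A i 0) z *s (C i *v v))" by simp
  then have "A i 0 = C i *v ((det3 (A i 0) (C i *v v) z / ?D) *s u + (det3 (C i *v u) (A i 0) z / ?D) *s v)"
    using D by (simp add: matrix_vector_right_distrib vec.scale vector_add_ldistrib)
  then obtain y where y: "y \<in> L" "A i 0 = C i *v y"
    unfolding uv(2) span2_def by blast
  moreover obtain t where "R i *v (C i *v y) = y + t *s c i" using lift_image by blast
  ultimately have "R i *v A i 0 + (- t) *s c i = y" by simp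
  then show ?thesis using y(1) by metis
qed

text \<open>Suppose that \<open>c k\<close> is on \<open>L\<close>. If \<open>L\<close> meets a ray, it lies in the plane that \<open>c k\<close> spans
  with this ray. With \<open>h\<close> these are three planes that contain \<open>L\<close>, so they are dependent.\<close>

lemma center_not_on_line_meeting_rays:
  assumes "cross4 (cross4 (c i) b (c k)) (cross4 (c j) b' (c k)) h \<noteq> 0"
    and "L \<in> grassmannian 2"
    and "\<And>y. y \<in> L \<Longrightarrow> c k \<in> L \<Longrightarrow> det4 (c i) b (c k) y = 0"
    and "\<And>y. y \<in> L \<Longrightarrow> c k \<in> L \<Longrightarrow> det4 (c j) b' (c k) y = 0"
    and "\<And>y. y \<in> L \<Longrightarrow> c k \<in> L \<Longrightarrow> h \<cdot> y = 0"
  shows "c k \<notin> L"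
proof
  assume ck: "c k \<in> L"
  obtain u v where uv: "indep2 u v" "L = span2 u v"
    using assms(2) unfolding grassmannian_2_iff by blast
  then have "u \<in> L" "v \<in> L" by (simp_all add: in_span2)
  then have "cross4 (cross4 (c i) b (c k)) (cross4 (c j) b' (c k)) h = 0"
    using assms(3-5) ck by (intro planes_of_pencil_dependent[OF uv(1)])
      (auto simp: cross4_dot_eq_det4)
  with assms(1) show False ..
qed

section \<open>The three multidegrees\<close>

text \<open>The plane that the two forms on factor \<open>i\<close> cut out contains no center except \<open>c i\<close>.\<close>

definition plane_avoids_other_centers :: "'m \<Rightarrow> ('m \<Rightarrow> nat \<Rightarrow> complex^3) \<Rightarrow> bool" where
  "plane_avoids_other_centers i A \<longleftrightarrow> (\<forall>k. k \<noteq> i \<longrightarrow> det4 (c i) (R i *v A i 0) (R i *v A i 1) (c k) \<noteq> 0)"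

lemma generically_plane_avoids_other_centers:
  assumes "d i = 2"
  shows "generically form_coords (linear_forms d) (plane_avoids_other_centers i)"
  unfolding plane_avoids_other_centers_def
proof (intro generically_all generically_imp closed_under_lines_linear_forms linear_forms_nonempty)
  fix k assume "k \<noteq> i"
  then obtain a b where ab: "det3 a b (C i *v c k) \<noteq> 0"
    using ex_det3_nonzero two_centers by metis
  obtain A :: "'m \<Rightarrow> nat \<Rightarrow> complex^3" where A: "A \<in> linear_forms d"
    "\<And>l n. n < d l \<Longrightarrow> A l n = (if n = 0 then a else b)"
    using ex_linear_forms[of d "\<lambda>l n. if n = 0 then a else b"] by blast
  have "A i 0 = a" "A i 1 = b" using A(2) assms by simp_all
  then show "generically form_coords (linear_forms d)
      (\<lambda>A. det4 (c i) (R i *v A i 0) (R i *v A i 1) (c k) \<noteq> 0)"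
    by (intro generically_nonzero[OF _ A(1)])
       (intro polynomial_intros, use ab in \<open>simp add: det4_lift2\<close>)
qed

lemma has_multidegree_if_generic_incident:
  assumes "generically form_coords (linear_forms d) P"
    and "\<And>A L i. P A \<Longrightarrow> L \<in> incident_lines d A \<Longrightarrow> c i \<notin> L"
    and "\<And>A x. P A \<Longrightarrow> (\<And>i. x i \<noteq> 0 \<and> x i \<in> forms_locus (d i) (A i)) \<Longrightarrow>
      \<exists>i j. x i \<cdot> (C i *v c j) \<noteq> 0"
    and "\<And>A. P A \<Longrightarrow> card (incident_lines d A) = n" and "n \<noteq> 0"
  shows "has_multidegree (line_multiview_variety C) d n"
proof (rule has_multidegree_if_generically, rule generically_mono[OF assms(1)])
  fix A assume P: "P A"
  have bij: "bij_betw (joint_camera_map C) (incident_lines d A)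
      (linear_section (line_multiview_variety C) d A)"
    using joint_camera_map_bij assms(2,3)[OF P] by blast
  moreover have "finite (incident_lines d A)"
    using assms(4)[OF P] assms(5) card.infinite by fastforce
  ultimately show "finite (linear_section (line_multiview_variety C) d A)
      \<and> card (linear_section (line_multiview_variety C) d A) = n"
    using bij_betw_finite bij_betw_same_card assms(4)[OF P] by metis
qed

text \<open>The two planes meet in a line. It avoids all centers, since each center is on at
  most one of the planes.\<close>

lemma multidegree_2_2:
  assumes ij: "i \<noteq> j" and d: "d i = 2" "d j = 2" and d0: "\<And>k. k \<notin> {i, j} \<Longrightarrow> d k = 0"
  shows "has_multidegree (line_multiview_variety C) d 1"
proof (rule has_multidegree_if_generic_incident)
  show "generically form_coords (linear_forms d)
      (\<lambda>A. plane_avoids_other_centers i A \<and> plane_avoids_other_centers j A)"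
    using d by (intro generically_conj closed_under_lines_linear_forms generically_plane_avoids_other_centers)
  fix A assume "plane_avoids_other_centers i A \<and> plane_avoids_other_centers j A"
  then have A: "\<And>k. k \<noteq> i \<Longrightarrow> det4 (c i) (R i *v A i 0) (R i *v A i 1) (c k) \<noteq> 0"
    "\<And>k. k \<noteq> j \<Longrightarrow> det4 (c j) (R j *v A j 0) (R j *v A j 1) (c k) \<noteq> 0"
    by (simp_all add: plane_avoids_other_centers_def)
  show "c k \<notin> L" if L: "L \<in> incident_lines d A" for L k
    using A(1)[of k] A(2)[of k] ij incident_line_in_plane[OF L, of 0 i 1 "c k"]
      incident_line_in_plane[OF L, of 0 j 1 "c k"] d by auto
  show "\<exists>i j. x i \<cdot> (C i *v c j) \<noteq> 0"
    if x: "\<And>i. x i \<noteq> 0 \<and> x i \<in> forms_locus (d i) (A i)" for x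
  proof -
    have "x i \<noteq> 0" "x i \<in> forms_locus (d i) (A i)" using x by blast+
    then have "x i \<cdot> (C i *v c j) \<noteq> 0"
      by (rule plane_det4_nonzero[where k = 0 and k' = 1, rotated -2]) (use A(1)[of j] ij d in simp_all)
    then show ?thesis by (intro exI)
  qed
  define x y where "x = cross (A i 0) (A i 1)" and "y = cross (A j 0) (A j 1)"
  have x_det: "x \<cdot> (C i *v w) = det4 (c i) (R i *v A i 0) (R i *v A i 1) w" for w
    unfolding x_def det4_lift2 det3_cross(1) ..
  have y_det: "y \<cdot> (C j *v w) = det4 (c j) (R j *v A j 0) (R j *v A j 1) w" for w
    unfolding y_def det4_lift2 det3_cross(1) ..
  let ?L = "{w. x \<cdot> (C i *v w) = 0 \<and> y \<cdot> (C j *v w) = 0}"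
  have xj: "x \<cdot> (C i *v c j) \<noteq> 0" and yi: "y \<cdot> (C j *v c i) \<noteq> 0"
    using A ij by (simp_all add: x_det y_det)
  then have xy: "x \<noteq> 0" "y \<noteq> 0" by auto
  have L2: "?L \<in> grassmannian 2"
    using pencil_line[of "\<lambda>k. if k = i then x else y" i j] xy xj ij by simp
  then obtain u v where uv: "indep2 u v" "?L = span2 u v"
    unfolding grassmannian_2_iff by blast
  then have uvL: "u \<in> ?L" "v \<in> ?L" by (simp_all only: in_span2)
  have "span2 u v \<in> incident_lines d A"
  proof (rule span2_incident_lines[OF uv(1)])
    show "c k \<notin> span2 u v" for k
      unfolding uv(2)[symmetric] using A(1)[of k] A(2)[of k] ij by (auto simp: x_det y_det)
    fix k n assume n: "n < d k"
    then have "k = i \<or> k = j" using d0[of k] by auto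
    then show "det4 (c k) (R k *v A k n) u v = 0"
    proof
      assume k: "k = i"
      have "det3 (A i n) (C i *v u) (C i *v v) = 0"
        by (rule det3_eq_0[OF xy(1)])
           (use n d uvL less_2_cases[of n] in \<open>auto simp: k x_def\<close>)
      then show ?thesis by (simp add: k det4_lift)
    next
      assume k: "k = j"
      have "det3 (A j n) (C j *v u) (C j *v v) = 0"
        by (rule det3_eq_0[OF xy(2)])
           (use n d uvL less_2_cases[of n] in \<open>auto simp: k y_def\<close>)
      then show ?thesis by (simp add: k det4_lift)
    qed
  qed
  moreover have "L = ?L" if L: "L \<in> incident_lines d A" for L
  proof (rule grassmannian_subset_eq[OF _ L2])
    show "L \<in> grassmannian 2" using L by (simp add: incident_lines_def)
    show "L \<subseteq> ?L"
      using incident_line_in_plane[OF L, of 0 _ 1] d by (auto simp: x_det y_det)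
  qed
  ultimately show "card (incident_lines d A) = 1"
    unfolding uv(2) by (rule card_1_if_unique)
qed simp

text \<open>The ray of \<open>k\<close> (for \<open>k = j\<close> and \<open>k = l\<close>) meets the plane of \<open>i\<close> in one point \<open>y k\<close>, since \<open>c k\<close> is
  not on the plane. The line is the join of \<open>y j\<close> and \<open>y l\<close>. For these points to be distinct
  and for the join to avoid \<open>c i\<close>, the plane and the planes that \<open>c i\<close> spans with the two
  rays have to be independent.\<close>

lemma multidegree_2_1_1:
  assumes distinct: "distinct [i, j, l]" and d: "d i = 2" "d j = 1" "d l = 1"
    and d0: "\<And>k. k \<notin> {i, j, l} \<Longrightarrow> d k = 0"
  shows "has_multidegree (line_multiview_variety C) d 1"
proof (rule has_multidegree_if_generic_incident)
  have neq: "j \<noteq> i" "l \<noteq> i" "j \<noteq> l" using distinct by auto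
  let ?f = "\<lambda>A. cross4 (c i) (R i *v A i 0) (R i *v A i 1)"
  let ?g = "\<lambda>A k. cross4 (c k) (R k *v A k 0) (c i)"
  have generic: "generically form_coords (linear_forms d)
      (\<lambda>A. cross4 (?g A j) (?g A l) (?f A) \<noteq> 0)"
  proof -
    \<comment> \<open>The three planes of the witness are coordinate planes through \<open>c i\<close>, for the basis
    of the three centers and \<open>e\<close>.\<close>
    obtain e where e: "det4 (c i) (c j) (c l) e \<noteq> 0" using three_centers[OF distinct] by blast
    define f where "f k n = (if k = i then if n = 0 then C i *v e else C i *v c j
      else if k = j then C j *v c l else C l *v e)" for k and n :: nat
    obtain A where A: "A \<in> linear_forms d" "\<And>k n. n < d k \<Longrightarrow> A k n = f k n"
      using ex_linear_forms[of d f] by blast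
    have vals: "A i 0 = C i *v e" "A i (Suc 0) = C i *v c j" "A j 0 = C j *v c l" "A l 0 = C l *v e"
      using A(2) d distinct by (auto simp: f_def)
    have perm: "det4 (c j) (c l) (c i) e = det4 (c i) (c j) (c l) e"
      "det4 (c l) e (c i) (c j) = det4 (c i) (c j) (c l) e"
      "det4 (c i) e (c j) (c l) = det4 (c i) (c j) (c l) e"
      unfolding det4_def scalar_product_4 cross4_nth minor3_def by algebra+
    have "cross4 (?g A j) (?g A l) (?f A) \<noteq> 0"
      by (rule cross4_triangular_nonzero[where p = e and q = "c j" and r = "c l"])
         (use e perm in \<open>auto simp: vals cross4_dot_eq_det4\<close>)
    then show ?thesis
      by (intro generically_vector_nonzero[OF _ A(1)] polynomial_intros)
  qed
  show "generically form_coords (linear_forms d)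
      (\<lambda>A. plane_avoids_other_centers i A \<and> cross4 (?g A j) (?g A l) (?f A) \<noteq> 0)"
    using d generic by (intro generically_conj closed_under_lines_linear_forms generically_plane_avoids_other_centers)
  fix A assume "plane_avoids_other_centers i A \<and> cross4 (?g A j) (?g A l) (?f A) \<noteq> 0"
  then have plane: "\<And>k. k \<noteq> i \<Longrightarrow> det4 (c i) (R i *v A i 0) (R i *v A i 1) (c k) \<noteq> 0"
    and independent: "cross4 (?g A j) (?g A l) (?f A) \<noteq> 0"
    by (simp_all add: plane_avoids_other_centers_def)
  show avoid: "c k \<notin> L" if L: "L \<in> incident_lines d A" for L k
  proof (cases "k = i")
    case False
    then show ?thesis using plane[of k] incident_line_in_plane[OF L, of 0 i 1 "c k"] d by auto
  next
    case True
    have "c i \<notin> L"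
    proof (rule center_not_on_line_meeting_rays[OF independent])
      show "L \<in> grassmannian 2" using L by (simp add: incident_lines_def)
      show "det4 (c j) (R j *v A j 0) (c i) y = 0" if "y \<in> L" "c i \<in> L" for y
        using incident_line_det4[OF L _ that(2,1)] d by simp
      show "det4 (c l) (R l *v A l 0) (c i) y = 0" if "y \<in> L" "c i \<in> L" for y
        using incident_line_det4[OF L _ that(2,1)] d by simp
      show "?f A \<cdot> y = 0" if "y \<in> L" "c i \<in> L" for y
        using incident_line_in_plane[OF L _ _ that(1), of 0 i 1] d by (simp add: cross4_dot_eq_det4)
    qed
    with True show ?thesis by simp
  qed
  show "\<exists>i j. x i \<cdot> (C i *v c j) \<noteq> 0"
    if x: "\<And>i. x i \<noteq> 0 \<and> x i \<in> forms_locus (d i) (A i)" for x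
  proof -
    have "x i \<noteq> 0" "x i \<in> forms_locus (d i) (A i)" using x by blast+
    then have "x i \<cdot> (C i *v c j) \<noteq> 0"
      by (rule plane_det4_nonzero[where k = 0 and k' = 1, rotated -2])
         (use plane[of j] neq d in simp_all)
    then show ?thesis by (intro exI)
  qed
  \<comment> \<open>\<open>f\<close> is the plane of \<open>i\<close> as a linear form.\<close>
  define f where "f y = det4 (c i) (R i *v A i 0) (R i *v A i 1) y" for y
  have f_linear: "f (a *s u + b *s v) = a * f u + b * f v" for a b u v by (simp add: f_def)
  define b where "b k = R k *v A k 0" for k
  define t where "t k = - f (b k) / f (c k)" for k
  define y where "y k = b k + t k *s c k" for k
  have f_center: "f (c k) \<noteq> 0" if "k \<noteq> i" for k using plane[OF that] by (simp add: f_def)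
  have f_y: "f (y k) = 0" if "k \<noteq> i" for k
    using f_center[OF that] f_linear[of 1 "b k" "t k" "c k"] by (simp add: y_def t_def)
  have f_i: "f (c i) = 0" by (simp add: f_def)
  have on_ray: "det4 (c k) (b k) w (y k) = 0" for k w by (simp add: y_def)
  \<comment> \<open>\<open>g k\<close> is the plane spanned by \<open>c i\<close> and the ray of \<open>k\<close>.\<close>
  define g where "g k w = det4 (c k) (b k) (c i) w" for k w
  have g_linear: "g k (r *s u + s *s v) = r * g k u + s * g k v" for k r s u v
    by (simp add: g_def)
  have g_y: "g k (y k) = 0" for k by (simp add: g_def on_ray)
  have g_i: "g k (c i) = 0" for k by (simp add: g_def)
  have ci: "c i \<noteq> 0" using center_nonzero[of j i] neq by simp
  \<comment> \<open>Otherwise all three planes contain \<open>y k\<close> and \<open>c i\<close>. If these are the same point, then \<open>c i\<close> is on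
    the ray of \<open>k\<close>, which does not span a plane with it.\<close>
  have separated: "\<not> (g j (y k) = 0 \<and> g l (y k) = 0)" if k: "k \<in> {j, l}" for k
  proof
    assume 0: "g j (y k) = 0 \<and> g l (y k) = 0"
    show False
    proof (cases "indep2 (y k) (c i)")
      case True
      have "f (y k) = 0" using f_y k neq by auto
      then have "cross4 (?g A j) (?g A l) (?f A) = 0"
        using 0 f_i by (intro planes_of_pencil_dependent[OF True])
          (auto simp: cross4_dot_eq_det4 g_def f_def b_def)
      with independent show False ..
    next
      case False
      then obtain m where "y k = m *s c i" using ci by (auto simp: indep2_iff)
      then have "b k = m *s c i + (- t k) *s c k" by (simp add: y_def eq_diff_eq)
      then have "?g A k = 0" unfolding b_def by simp
      then show False using independent k by auto
    qed
  qed
  have g_y': "g l (y j) \<noteq> 0" "g j (y l) \<noteq> 0"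
    using separated[of j] separated[of l] g_y by auto
  have claim: "r = 0 \<and> s = 0" if "r *s y j + s *s y l = m *s c i" for r s m
  proof -
    have "g k (r *s y j + s *s y l) = 0" for k
      unfolding that using g_i[of k] by (simp add: g_def)
    then have "r * g l (y j) = 0" "s * g j (y l) = 0"
      using g_y unfolding g_linear by (metis add.right_neutral add.left_neutral mult_zero_right)+
    then show ?thesis using g_y' by simp
  qed
  have indep: "indep2 (y j) (y l)"
    unfolding indep2_def using claim[of _ _ 0] by simp
  have f_span: "f w = 0" if w: "w \<in> span2 (y j) (y l)" for w
  proof -
    obtain r s where "w = r *s y j + s *s y l" using w unfolding span2_def by blast
    then show ?thesis using f_y[of j] f_y[of l] neq by (simp add: f_linear)
  qed
  have "span2 (y j) (y l) \<in> incident_lines d A"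
  proof (rule span2_incident_lines[OF indep])
    show "c k \<notin> span2 (y j) (y l)" for k
    proof
      assume k: "c k \<in> span2 (y j) (y l)"
      have "k = i" using f_span[OF k] f_center[of k] by auto
      then obtain r s where rs: "r *s y j + s *s y l = 1 *s c i"
        using k unfolding span2_def by auto
      then show False using claim[OF rs] ci by simp
    qed
    fix k n assume n: "n < d k"
    then have "k \<in> {i, j, l}" using d0[of k] by fastforce
    then have "k = i \<or> (k = j \<or> k = l) \<and> n = 0" using n d by auto
    then show "det4 (c k) (R k *v A k n) (y j) (y l) = 0"
    proof
      assume k: "k = i"
      let ?x = "cross (A i 0) (A i 1)"
      have x: "?x \<cdot> (C i *v w) = f w" for w
        unfolding f_def det4_lift2 det3_cross(1) ..
      have "?x \<cdot> (C i *v c j) \<noteq> 0" unfolding x using f_center neq by simp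
      then have "?x \<noteq> 0" by auto
      moreover have "?x \<cdot> A i n = 0" using n d k less_2_cases[of n] by auto
      moreover have "?x \<cdot> (C i *v y j) = 0" "?x \<cdot> (C i *v y l) = 0"
        unfolding x using f_y neq by auto
      ultimately have "det3 (A i n) (C i *v y j) (C i *v y l) = 0" by (rule det3_eq_0)
      then show ?thesis by (simp add: k det4_lift)
    next
      assume "(k = j \<or> k = l) \<and> n = 0"
      then show ?thesis by (auto simp: y_def b_def)
    qed
  qed
  moreover have "L = span2 (y j) (y l)" if L: "L \<in> incident_lines d A" for L
  proof -
    have "y k \<in> L" if k: "k \<in> {j, l}" for k
    proof -
      obtain t' where t': "b k + t' *s c k \<in> L"
        using incident_line_meets_ray[OF L _ avoid[OF L], of k] k d by (auto simp: b_def)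
      have "f (b k + t' *s c k) = 0"
        unfolding f_def by (rule incident_line_in_plane[OF L _ _ t']) (simp_all add: d)
      then have "f (b k) + t' * f (c k) = 0" using f_linear[of 1 "b k" t' "c k"] by simp
      then have "t' = t k"
        using f_center[of k] k neq by (auto simp: t_def field_simps eq_neg_iff_add_eq_0)
      with t' show ?thesis by (simp add: y_def)
    qed
    then have "span2 (y j) (y l) \<subseteq> L"
      using L by (auto simp: span2_def incident_lines_def grassmannian_def
          intro!: vec.subspace_add vec.subspace_scale)
    moreover have "span2 (y j) (y l) \<in> grassmannian 2"
      unfolding grassmannian_2_iff using indep by blast
    ultimately show ?thesis
      using grassmannian_subset_eq[of "span2 (y j) (y l)" 2 L] L by (simp add: incident_lines_def)
  qed
  ultimately show "card (incident_lines d A) = 1" by (rule card_1_if_unique)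
qed simp

text \<open>The planes that \<open>c k\<close> spans with three rays are independent, so no line through \<open>c k\<close> meets all three.
  A witness is given by the sides of the triangle of the centers \<open>c p\<close>, \<open>c q\<close>, \<open>c r\<close>.\<close>

lemma generically_no_transversal_through_center:
  assumes distinct: "distinct [p, q, r, k]" and d: "d p = 1" "d q = 1" "d r = 1"
  shows "generically form_coords (linear_forms d) (\<lambda>A.
    cross4 (cross4 (c p) (R p *v A p 0) (c k)) (cross4 (c q) (R q *v A q 0) (c k))
      (cross4 (c r) (R r *v A r 0) (c k)) \<noteq> 0)"
proof -
  define f where "f m n = (if m = p then C p *v c q else if m = q then C q *v c r else C r *v c p)"
    for m and n :: nat
  obtain A where A: "A \<in> linear_forms d" "\<And>m n. n < d m \<Longrightarrow> A m n = f m n"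
    using ex_linear_forms[of d f] by blast
  have neq: "p \<noteq> q" "q \<noteq> p" "p \<noteq> r" "r \<noteq> p" "q \<noteq> r" "r \<noteq> q" using distinct by auto
  have vals: "A p 0 = C p *v c q" "A q 0 = C q *v c r" "A r 0 = C r *v c p"
    using A(2) d neq by (auto simp: f_def)
  have "det4 (c p) (c q) (c k) (c r) \<noteq> 0" "det4 (c q) (c r) (c k) (c p) \<noteq> 0"
    "det4 (c r) (c p) (c k) (c q) \<noteq> 0"
    using distinct by (auto intro!: four_centers)
  then have "cross4 (cross4 (c p) (R p *v A p 0) (c k)) (cross4 (c q) (R q *v A q 0) (c k))
      (cross4 (c r) (R r *v A r 0) (c k)) \<noteq> 0"
    by (intro cross4_triangular_nonzero[where p = "c r" and q = "c p" and r = "c q"])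
       (auto simp: vals cross4_dot_eq_det4)
  then show ?thesis
    by (intro generically_vector_nonzero[OF _ A(1)] polynomial_intros)
qed

text \<open>It vanishes iff the line through \<open>y\<close> and \<open>z\<close> meets the ray of \<open>A k 0\<close>.\<close>

definition ray_form :: "('m \<Rightarrow> nat \<Rightarrow> complex^3) \<Rightarrow> 'm \<Rightarrow> complex^4 \<Rightarrow> complex^4 \<Rightarrow> complex" where
  "ray_form A k y z = det4 (c k) (R k *v A k 0) y z"

text \<open>The hypotheses of \<open>two_bilinear_equations\<close> for the lines that join the points \<open>b i + s c i\<close>
  and \<open>b j + t c j\<close> and meet the rays of \<open>k\<close> and \<open>l\<close>. The values \<open>s = \<infinity>\<close> and \<open>t = \<infinity>\<close> stand for the
  centers \<open>c i\<close> and \<open>c j\<close>.\<close>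

definition two_transversals :: "'m \<Rightarrow> 'm \<Rightarrow> 'm \<Rightarrow> 'm \<Rightarrow> ('m \<Rightarrow> nat \<Rightarrow> complex^3) \<Rightarrow> bool" where
  "two_transversals i j k l A \<longleftrightarrow>
    (let b = \<lambda>k. R k *v A k 0; M = ray_form A k; N = ray_form A l in
      M (c i) (b j) * N (c i) (c j) - N (c i) (b j) * M (c i) (c j) \<noteq> 0 \<and>
      M (b i) (c j) * N (c i) (c j) - N (b i) (c j) * M (c i) (c j) \<noteq> 0 \<and>
      (M (b i) (b j) * N (c i) (c j) + M (c i) (b j) * N (b i) (c j)
        - N (b i) (b j) * M (c i) (c j) - N (c i) (b j) * M (b i) (c j))\<^sup>2
      - 4 * (M (c i) (b j) * N (c i) (c j) - N (c i) (b j) * M (c i) (c j))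
        * (M (b i) (b j) * N (b i) (c j) - N (b i) (b j) * M (b i) (c j)) \<noteq> 0)"

lemma polynomial_fun_ray_form [polynomial_intros]:
  assumes "\<And>s. polynomial_fun form_coords (\<lambda>A. f A $ s)" "\<And>s. polynomial_fun form_coords (\<lambda>A. g A $ s)"
  shows "polynomial_fun form_coords (\<lambda>A. ray_form A k (f A) (g A))"
  unfolding ray_form_def by (intro polynomial_intros assms)

text \<open>The rays that matter for each of the three polynomials join centers in the witness. Most determinants
  then have a repeated center and vanish. For the discriminant the rays join \<open>i\<close> to
  \<open>k\<close>, \<open>j\<close> to \<open>l\<close>, \<open>k\<close> to \<open>j\<close> and \<open>l\<close> to \<open>i\<close>. These are the sides of a skew quadrilateral, whose
  diagonals are the two transversals.\<close>

lemma generically_two_transversals: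
  assumes distinct: "distinct [i, j, k, l]" and d: "d i = 1" "d j = 1" "d k = 1" "d l = 1"
  shows "generically form_coords (linear_forms d) (two_transversals i j k l)"
proof -
  have neq: "i \<noteq> j" "j \<noteq> i" "i \<noteq> k" "k \<noteq> i" "i \<noteq> l" "l \<noteq> i" "j \<noteq> k" "k \<noteq> j" "j \<noteq> l" "l \<noteq> j"
    "k \<noteq> l" "l \<noteq> k" using distinct by auto
  have witness: "\<exists>A\<in>linear_forms d. A i 0 = C i *v u \<and> A j 0 = C j *v v \<and> A k 0 = C k *v w \<and> A l 0 = C l *v x"
    for u v w x
  proof -
    obtain A where "A \<in> linear_forms d" "\<And>m n. n < d m \<Longrightarrow> A m n = (if m = i then C i *v u
        else if m = j then C j *v v else if m = k then C k *v w else C l *v x)"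
      using ex_linear_forms[of d "\<lambda>m n. if m = i then C i *v u else if m = j then C j *v v
        else if m = k then C k *v w else C l *v x"] by blast
    then show ?thesis using neq d by (intro bexI[of _ A]) auto
  qed
  have lift: "\<exists>t. R m *v (C m *v x) = x + t *s c m" for m x by (rule lift_image)
  show ?thesis
    unfolding two_transversals_def Let_def
  proof (intro generically_conj closed_under_lines_linear_forms)
    obtain A where A: "A \<in> linear_forms d"
      "A i 0 = 0" "A j 0 = C j *v c k" "A k 0 = C k *v c l" "A l 0 = C l *v c j"
      using witness[of 0 "c k" "c l" "c j"] by auto
    obtain t where t: "R j *v (C j *v c k) = c k + t *s c j" using lift by blast
    have "det4 (c l) (c j) (c i) (c k) \<noteq> 0" "det4 (c k) (c l) (c i) (c j) \<noteq> 0"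
      using neq by (auto intro!: four_centers)
    then show "generically form_coords (linear_forms d) (\<lambda>A.
        ray_form A k (c i) (R j *v A j 0) * ray_form A l (c i) (c j)
        - ray_form A l (c i) (R j *v A j 0) * ray_form A k (c i) (c j) \<noteq> 0)"
      by (intro generically_nonzero[OF _ A(1)])
         (intro polynomial_intros, simp add: ray_form_def A t)
  next
    obtain A where A: "A \<in> linear_forms d"
      "A i 0 = C i *v c k" "A j 0 = 0" "A k 0 = C k *v c l" "A l 0 = C l *v c i"
      using witness[of "c k" 0 "c l" "c i"] by auto
    obtain t where t: "R i *v (C i *v c k) = c k + t *s c i" using lift by blast
    have "det4 (c l) (c i) (c k) (c j) \<noteq> 0" "det4 (c k) (c l) (c i) (c j) \<noteq> 0"
      using neq by (auto intro!: four_centers)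
    then show "generically form_coords (linear_forms d) (\<lambda>A.
        ray_form A k (R i *v A i 0) (c j) * ray_form A l (c i) (c j)
        - ray_form A l (R i *v A i 0) (c j) * ray_form A k (c i) (c j) \<noteq> 0)"
      by (intro generically_nonzero[OF _ A(1)])
         (intro polynomial_intros, simp add: ray_form_def A t)
  next
    obtain A where A: "A \<in> linear_forms d"
      "A i 0 = C i *v c k" "A j 0 = C j *v c l" "A k 0 = C k *v c j" "A l 0 = C l *v c i"
      using witness[of "c k" "c l" "c j" "c i"] by auto
    obtain t where t: "R i *v (C i *v c k) = c k + t *s c i" using lift by blast
    obtain t' where t': "R j *v (C j *v c l) = c l + t' *s c j" using lift by blast
    have "det4 (c k) (c j) (c i) (c l) \<noteq> 0" "det4 (c l) (c i) (c k) (c j) \<noteq> 0"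
      using neq by (auto intro!: four_centers)
    then show "generically form_coords (linear_forms d) (\<lambda>A.
      (ray_form A k (R i *v A i 0) (R j *v A j 0) * ray_form A l (c i) (c j)
        + ray_form A k (c i) (R j *v A j 0) * ray_form A l (R i *v A i 0) (c j)
        - ray_form A l (R i *v A i 0) (R j *v A j 0) * ray_form A k (c i) (c j)
        - ray_form A l (c i) (R j *v A j 0) * ray_form A k (R i *v A i 0) (c j))\<^sup>2
      - 4 * (ray_form A k (c i) (R j *v A j 0) * ray_form A l (c i) (c j)
          - ray_form A l (c i) (R j *v A j 0) * ray_form A k (c i) (c j))
        * (ray_form A k (R i *v A i 0) (R j *v A j 0) * ray_form A l (R i *v A i 0) (c j)
          - ray_form A l (R i *v A i 0) (R j *v A j 0) * ray_form A k (R i *v A i 0) (c j)) \<noteq> 0)"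
      by (intro generically_nonzero[OF _ A(1)])
         (intro polynomial_intros, simp add: ray_form_def A t t')
  qed
qed

lemma generically_rays_skew:
  assumes distinct: "distinct [i, j, k, l]" and d: "d i = 1" "d j = 1"
  shows "generically form_coords (linear_forms d)
    (\<lambda>A. det4 (c i) (R i *v A i 0) (c j) (R j *v A j 0) \<noteq> 0)"
proof -
  obtain A where A: "A \<in> linear_forms d"
    "\<And>m n. n < d m \<Longrightarrow> A m n = (if m = i then C i *v c k else C j *v c l)"
    using ex_linear_forms[of d "\<lambda>m n. if m = i then C i *v c k else C j *v c l"] by blast
  have vals: "A i 0 = C i *v c k" "A j 0 = C j *v c l"
    using A(2) d distinct by auto
  obtain t where t: "R j *v (C j *v c l) = c l + t *s c j" using lift_image by blast
  have "det4 (c i) (c k) (c j) (c l) \<noteq> 0"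
    using distinct by (intro four_centers) auto
  then show ?thesis
    by (intro generically_nonzero[OF _ A(1)]) (intro polynomial_intros, simp add: vals t)
qed

text \<open>An incident line avoids all centers, so it meets the rays of \<open>i\<close> and \<open>j\<close> in points
  \<open>Y s = b i + s c i\<close> and \<open>Z t = b j + t c j\<close>. As these rays are skew, \<open>s\<close> and \<open>t\<close> are determined by the
  line, and the line by \<open>s\<close> and \<open>t\<close>. It remains to meet the rays of \<open>k\<close> and \<open>l\<close>, which are two
  bilinear equations in \<open>s\<close> and \<open>t\<close>.\<close>

lemma multidegree_1_1_1_1:
  assumes distinct: "distinct [i, j, k, l]" and d: "d i = 1" "d j = 1" "d k = 1" "d l = 1"
    and d0: "\<And>m. m \<notin> {i, j, k, l} \<Longrightarrow> d m = 0"
  shows "has_multidegree (line_multiview_variety C) d 2"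
proof (rule has_multidegree_if_generic_incident)
  let ?b = "\<lambda>A p. R p *v A p 0"
  let ?P = "\<lambda>A. (\<forall>m p q r. distinct [p, q, r, m] \<and> {p, q, r} \<subseteq> {i, j, k, l} \<longrightarrow>
      cross4 (cross4 (c p) (?b A p) (c m)) (cross4 (c q) (?b A q) (c m)) (cross4 (c r) (?b A r) (c m)) \<noteq> 0)
    \<and> two_transversals i j k l A \<and> det4 (c i) (?b A i) (c j) (?b A j) \<noteq> 0"
  have d1: "d p = 1" if "p \<in> {i, j, k, l}" for p using that d by auto
  have "generically form_coords (linear_forms d) (\<lambda>A. cross4 (cross4 (c p) (?b A p) (c m))
      (cross4 (c q) (?b A q) (c m)) (cross4 (c r) (?b A r) (c m)) \<noteq> 0)"
    if "distinct [p, q, r, m] \<and> {p, q, r} \<subseteq> {i, j, k, l}" for m p q r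
    using that d1 by (intro generically_no_transversal_through_center) blast+
  then show "generically form_coords (linear_forms d) ?P"
    by (intro generically_conj generically_all generically_imp closed_under_lines_linear_forms
        linear_forms_nonempty generically_two_transversals[OF distinct d]
        generically_rays_skew[OF distinct d(1,2)])
  fix A assume P: "?P A"
  define b where "b p = ?b A p" for p
  have skew: "det4 (c i) (b i) (c j) (b j) \<noteq> 0" using P by (simp add: b_def)
  have neq: "i \<noteq> j" "j \<noteq> i" "i \<noteq> k" "k \<noteq> i" "i \<noteq> l" "l \<noteq> i" "j \<noteq> k" "k \<noteq> j" "j \<noteq> l" "l \<noteq> j"
    "k \<noteq> l" "l \<noteq> k" using distinct by auto
  have avoid: "c m \<notin> L" if L: "L \<in> grassmannian 2"
    and rays: "\<And>p y z. p \<in> {i, j, k, l} \<Longrightarrow> y \<in> L \<Longrightarrow> z \<in> L \<Longrightarrow> det4 (c p) (b p) y z = 0" for L m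
  proof -
    \<comment> \<open>Among the four rays there are three that do not belong to camera \<open>m\<close>.\<close>
    obtain p q r where pqr: "distinct [p, q, r, m]" "{p, q, r} \<subseteq> {i, j, k, l}"
    proof (cases "m = i \<or> m = j")
      case True
      then show ?thesis using that[of k l "if m = i then j else i"] neq by auto
    next
      case False
      then show ?thesis using that[of i j "if m = k then l else k"] neq by auto
    qed
    then have "cross4 (cross4 (c p) (b p) (c m)) (cross4 (c q) (b q) (c m))
        (cross4 (c r) (b r) (c m)) \<noteq> 0"
      using P unfolding b_def by blast
    then show ?thesis
      by (rule center_not_on_line_meeting_rays[OF _ L])
         (use pqr(2) rays in \<open>auto simp: cross4_dot_eq_det4\<close>)
  qed
  show avoid_incident: "c m \<notin> L" if L: "L \<in> incident_lines d A" for L m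
    using L by (intro avoid) (auto simp: incident_lines_def b_def d1 intro!: incident_line_det4[OF L])
  show "\<exists>i j. x i \<cdot> (C i *v c j) \<noteq> 0"
    if x: "\<And>i. x i \<noteq> 0 \<and> x i \<in> forms_locus (d i) (A i)" for x
  proof (rule ccontr)
    \<comment> \<open>Otherwise the plane of camera \<open>i\<close> contains the four centers, which span space.\<close>
    assume "\<nexists>i j. x i \<cdot> (C i *v c j) \<noteq> 0"
    then have "back_projection (C i) (x i) \<cdot> c m = 0" for m by (simp add: back_projection)
    then have "back_projection (C i) (x i) = 0"
      using det4_kernel[OF four_centers[OF distinct]] by blast
    then show False using back_projection_nonzero[of "x i" i] x by blast
  qed
  let ?M = "ray_form A k" and ?N = "ray_form A l"
  define Y where "Y s = b i + s *s c i" for s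
  define Z where "Z t = b j + t *s c j" for t
  define S where "S = {(s, t). ?M (Y s) (Z t) = 0 \<and> ?N (Y s) (Z t) = 0}"
  have bilinear: "ray_form A m (Y s) (Z t) = ray_form A m (b i) (b j) + ray_form A m (c i) (b j) * s
      + ray_form A m (b i) (c j) * t + ray_form A m (c i) (c j) * s * t" for m s t
    by (simp add: ray_form_def Y_def Z_def algebra_simps)
  have card_S: "card S = 2"
    unfolding S_def bilinear
    by (rule two_bilinear_equations) (use P in \<open>simp_all add: two_transversals_def Let_def b_def\<close>)
  have indep_rays: "\<alpha> = 0 \<and> \<beta> = 0 \<and> \<gamma> = 0 \<and> \<delta> = 0"
    if "\<alpha> *s c i + \<beta> *s b i + \<gamma> *s c j + \<delta> *s b j = 0" for \<alpha> \<beta> \<gamma> \<delta>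
    by (rule det4_independent[OF skew that])
  have indep: "indep2 (Y s) (Z t)" for s t
    unfolding indep2_def
  proof (intro allI impI)
    fix u v assume "u *s Y s + v *s Z t = 0"
    then have "(u * s) *s c i + u *s b i + (v * t) *s c j + v *s b j = 0"
      by (simp add: Y_def Z_def algebra_simps)
    then show "u = 0 \<and> v = 0" using indep_rays by blast
  qed
  have lines: "span2 (Y s) (Z t) \<in> grassmannian 2" for s t
    unfolding grassmannian_2_iff using indep by blast
  have "bij_betw (\<lambda>(s, t). span2 (Y s) (Z t)) S (incident_lines d A)"
    unfolding bij_betw_def
  proof
    show "inj_on (\<lambda>(s, t). span2 (Y s) (Z t)) S"
    proof (rule inj_onI, clarify)
      fix s t s' t' assume "span2 (Y s) (Z t) = span2 (Y s') (Z t')"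
      then have in_span: "Y s' \<in> span2 (Y s) (Z t)" "Z t' \<in> span2 (Y s) (Z t)"
        by (simp_all add: in_span2)
      obtain u v where "Y s' = u *s Y s + v *s Z t"
        using in_span(1) unfolding span2_def by blast
      then have "(u * s - s') *s c i + (u - 1) *s b i + (v * t) *s c j + v *s b j = 0"
        by (simp add: Y_def Z_def vec_eq_iff algebra_simps)
      then have "u * s - s' = 0 \<and> u - 1 = 0 \<and> v * t = 0 \<and> v = 0" by (rule indep_rays)
      then have "s = s'" by auto
      moreover obtain u' v' where "Z t' = u' *s Y s + v' *s Z t"
        using in_span(2) unfolding span2_def by blast
      then have "(u' * s) *s c i + u' *s b i + (v' * t - t') *s c j + (v' - 1) *s b j = 0"
        by (simp add: Y_def Z_def vec_eq_iff algebra_simps)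
      then have "u' * s = 0 \<and> u' = 0 \<and> v' * t - t' = 0 \<and> v' - 1 = 0" by (rule indep_rays)
      then have "t = t'" by auto
      ultimately show "s = s' \<and> t = t'" by simp
    qed
    show "(\<lambda>(s, t). span2 (Y s) (Z t)) ` S = incident_lines d A"
    proof (intro set_eqI iffI)
      fix L assume "L \<in> (\<lambda>(s, t). span2 (Y s) (Z t)) ` S"
      then obtain s t where st: "(s, t) \<in> S" "L = span2 (Y s) (Z t)" by auto
      have rays: "det4 (c p) (b p) (Y s) (Z t) = 0" if "p \<in> {i, j, k, l}" for p
        using st(1) that by (auto simp: S_def ray_form_def b_def[of k] b_def[of l])
          (simp_all add: Y_def Z_def)
      have "det4 (c p) (b p) y z = 0" if "p \<in> {i, j, k, l}" "y \<in> L" "z \<in> L" for p y z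
        using that rays[of p] det4_swap_last[of "c p" "b p" "Z t" "Y s"]
        by (auto simp: st(2) span2_def)
      then have "c m \<notin> span2 (Y s) (Z t)" for m
        using avoid[OF lines] st(2) by blast
      then show "L \<in> incident_lines d A"
        unfolding st(2)
      proof (rule span2_incident_lines[OF indep])
        fix p n assume n: "n < d p"
        then have p: "p \<in> {i, j, k, l}" using d0[of p] by fastforce
        then have "n = 0" using n d1 by simp
        then show "det4 (c p) (R p *v A p n) (Y s) (Z t) = 0"
          using rays[OF p] by (simp add: b_def)
      qed
    next
      fix L assume L: "L \<in> incident_lines d A"
      obtain s where s: "Y s \<in> L"
        using incident_line_meets_ray[OF L _ avoid_incident[OF L], of i] d by (auto simp: Y_def b_def)
      obtain t where t: "Z t \<in> L"
        using incident_line_meets_ray[OF L _ avoid_incident[OF L], of j] d by (auto simp: Z_def b_def)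
      have "span2 (Y s) (Z t) \<subseteq> L"
        using L s t by (auto simp: span2_def incident_lines_def grassmannian_def
            intro!: vec.subspace_add vec.subspace_scale)
      then have "L = span2 (Y s) (Z t)"
        using grassmannian_subset_eq[of "span2 (Y s) (Z t)" 2 L] lines L by (simp add: incident_lines_def)
      moreover have "(s, t) \<in> S"
        using incident_line_det4[OF L _ s t] d by (simp add: S_def ray_form_def)
      ultimately show "L \<in> (\<lambda>(s, t). span2 (Y s) (Z t)) ` S" by force
    qed
  qed
  then show "card (incident_lines d A) = 2"
    using card_S bij_betw_same_card by metis
qed simp

end

section \<open>Cameras in general position\<close>

text \<open>By Cramer's rule the kernel is spanned by the vector of signed maximal minors, which makes
  the center a polynomial in the entries of the camera.\<close>

definition center_vector :: "complex^4^3 \<Rightarrow> complex^4" where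
  "center_vector C = cross4 (C $ 1) (C $ 2) (C $ 3)"

lemma matrix_vector_mult_nth: "((C :: complex^'n^'m) *v x) $ a = C $ a \<cdot> x"
  by (simp add: matrix_vector_mult_def scalar_product_def)

text \<open>The Cauchy--Binet formula, applied to the rows of \<open>C\<close> and the three points.\<close>

lemma camera_det3: "det3 (C *v x) (C *v y) (C *v z) = det4 (center_vector C) x y z"
  unfolding det4_def center_vector_def cross4_cauchy_binet det3_def minor3_def
    matrix_vector_mult_nth by algebra

lemma camera_kernel:
  assumes "center_vector C \<noteq> 0"
  shows "C *v x = 0 \<longleftrightarrow> (\<exists>t. x = t *s center_vector C)"
proof
  let ?c = "center_vector C"
  obtain w where w: "?c \<cdot> w \<noteq> 0" using assms by (rule scalar_product_nondegenerate)
  then have det: "det4 w (C $ 1) (C $ 2) (C $ 3) \<noteq> 0"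
    by (simp add: det4_def center_vector_def scalar_product_commute)
  assume "C *v x = 0"
  then have x: "x \<cdot> C $ a = 0" for a
    unfolding scalar_product_commute[of x] matrix_vector_mult_nth[symmetric] by simp
  have "x - (x \<cdot> w / ?c \<cdot> w) *s ?c = 0"
    by (rule det4_kernel[OF det])
       (use w x in \<open>simp_all add: center_vector_def scalar_product_commute[of "cross4 _ _ _" "C $ _"]\<close>)
  then have "x = (x \<cdot> w / ?c \<cdot> w) *s ?c" by simp
  then show "\<exists>t. x = t *s ?c" ..
next
  assume "\<exists>t. x = t *s center_vector C"
  then show "C *v x = 0"
    by (auto simp: vec_eq_3 matrix_vector_mult_nth center_vector_def)
qed

lemma camera_right_inverse:
  assumes "center_vector C \<noteq> 0"
  shows "\<exists>R. \<forall>a. C *v (R *v a) = a"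
proof -
  obtain w where w: "center_vector C \<cdot> w \<noteq> 0" using assms by (rule scalar_product_nondegenerate)
  then have det: "det4 w (C $ 1) (C $ 2) (C $ 3) \<noteq> 0"
    by (simp add: det4_def center_vector_def scalar_product_commute)
  have "\<exists>R. C ** R = mat 1"
    unfolding matrix_right_invertible_independent_rows
  proof (intro allI impI)
    fix f i assume "(\<Sum>i\<in>UNIV. f i *s row i C) = 0"
    then have "0 *s w + f 1 *s C $ 1 + f 2 *s C $ 2 + f 3 *s C $ 3 = 0"
      by (simp add: sum_3 row_def)
    then have "f 1 = 0 \<and> f 2 = 0 \<and> f 3 = 0"
      using det4_independent[OF det] by blast
    then show "f i = 0" using exhaust_3[of i] by auto
  qed
  then show ?thesis by (metis matrix_vector_mul_assoc matrix_vector_mul_lid)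
qed

lemma camera_rank:
  assumes "center_vector C \<noteq> 0"
  shows "pinhole_camera C"
proof -
  have rows: "rows C = {C $ 1, C $ 2, C $ 3}"
    by (auto simp: rows_def row_def) (metis exhaust_3)
  have "C $ 3 \<noteq> 0" using assms by (auto simp: center_vector_def)
  moreover have "C $ 2 \<noteq> k *s C $ 3" for k
    using assms by (auto simp: center_vector_def)
  moreover have "C $ 1 \<noteq> k *s C $ 2 + l *s C $ 3" for k l
    using assms by (auto simp: center_vector_def)
  ultimately have "C $ 3 \<noteq> 0" "C $ 2 \<notin> vec.span {C $ 3}" "C $ 1 \<notin> vec.span {C $ 2, C $ 3}"
    by (auto simp: vec.span_singleton span2_def simp flip: span2_eq_span)
  then show ?thesis
    unfolding pinhole_camera_def row_rank_def_gen rows by (simp add: vec.dim_insert)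
qed

text \<open>The rows are ordered so that the center is the axis vector itself, with positive sign.\<close>

definition axis_camera :: "4 \<Rightarrow> complex^4^3" where
  "axis_camera s = (if s = 1 then vector [axis 2 1, axis 3 1, axis 4 1]
     else if s = 2 then vector [axis 3 1, axis 1 1, axis 4 1]
     else if s = 3 then vector [axis 1 1, axis 2 1, axis 4 1]
     else vector [axis 2 1, axis 1 1, axis 3 1])"

lemma center_axis_camera: "center_vector (axis_camera s) = axis s 1"
proof -
  have "\<forall>s. center_vector (axis_camera s) = axis s 1"
    unfolding forall_4 by (simp add: axis_camera_def center_vector_def vec_eq_4 minor3_def axis_def)
  then show ?thesis ..
qed

lemma det4_axes: "det4 (axis 1 1) (axis 2 1) (axis 3 1) (axis 4 1) = 1"
  by (simp add: det4_def scalar_product_4 minor3_def axis_def)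

text \<open>Independence of two or three vectors in space is the nonvanishing of some minor. Completing
  them to four vectors by fixed axis vectors selects one of the minors, so that each
  condition is given by a single polynomial. This asks for more than independence, but it is
  still generic.\<close>

definition centers_in_general_position :: "('m::finite \<Rightarrow> complex^4^3) \<Rightarrow> bool" where
  "centers_in_general_position C \<longleftrightarrow>
    (\<forall>i. center_vector (C i) \<noteq> 0) \<and>
    (\<forall>i j. i \<noteq> j \<longrightarrow>
      det4 (center_vector (C i)) (center_vector (C j)) (axis 3 1) (axis 4 1) \<noteq> 0) \<and>
    (\<forall>i j k. distinct [i, j, k] \<longrightarrow>
      det4 (center_vector (C i)) (center_vector (C j)) (center_vector (C k)) (axis 4 1) \<noteq> 0) \<and>
    (\<forall>i j k l. distinct [i, j, k, l] \<longrightarrow>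
      det4 (center_vector (C i)) (center_vector (C j)) (center_vector (C k)) (center_vector (C l)) \<noteq> 0)"

lemma centers_in_general_positionD:
  assumes "centers_in_general_position C"
  shows "center_vector (C i) \<noteq> 0"
    and "i \<noteq> j \<Longrightarrow>
      det4 (center_vector (C i)) (center_vector (C j)) (axis 3 1) (axis 4 1) \<noteq> 0"
    and "distinct [i, j, k] \<Longrightarrow>
      det4 (center_vector (C i)) (center_vector (C j)) (center_vector (C k)) (axis 4 1) \<noteq> 0"
    and "distinct [i, j, k, l] \<Longrightarrow>
      det4 (center_vector (C i)) (center_vector (C j)) (center_vector (C k)) (center_vector (C l)) \<noteq> 0"
proof -
  note C = assms[unfolded centers_in_general_position_def]
  show "center_vector (C i) \<noteq> 0"
    by (rule C[THEN conjunct1, rule_format])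
  show "i \<noteq> j \<Longrightarrow>
      det4 (center_vector (C i)) (center_vector (C j)) (axis 3 1) (axis 4 1) \<noteq> 0"
    by (rule C[THEN conjunct2, THEN conjunct1, rule_format])
  show "distinct [i, j, k] \<Longrightarrow>
      det4 (center_vector (C i)) (center_vector (C j)) (center_vector (C k)) (axis 4 1) \<noteq> 0"
    by (rule C[THEN conjunct2, THEN conjunct2, THEN conjunct1, rule_format])
  show "distinct [i, j, k, l] \<Longrightarrow>
      det4 (center_vector (C i)) (center_vector (C j)) (center_vector (C k)) (center_vector (C l)) \<noteq> 0"
    by (rule C[THEN conjunct2, THEN conjunct2, THEN conjunct2, rule_format])
qed

lemma polynomial_fun_center_vector [polynomial_intros]:
  "polynomial_fun camera_coords (\<lambda>C. center_vector (C i) $ s)"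
  unfolding center_vector_def by (intro polynomial_intros)

text \<open>The witness for each determinant has its first centers at the axis points in order, so that
  the determinant is that of the identity matrix.\<close>

lemma generically_centers_in_general_position:
  "generically camera_coords UNIV (centers_in_general_position :: ('m::finite \<Rightarrow> _) \<Rightarrow> bool)"
proof -
  note all = generically_all[OF closed_under_lines_cameras UNIV_not_empty]
  note conj = generically_conj[OF closed_under_lines_cameras]
  note imp = generically_imp[OF UNIV_not_empty]
  define W :: "'m \<Rightarrow> 'm \<Rightarrow> 'm \<Rightarrow> 'm \<Rightarrow> complex^4^3" where
    "W i j k x = axis_camera (if x = i then 1 else if x = j then 2 else if x = k then 3 else 4)"
    for i j k x
  show ?thesis
    unfolding centers_in_general_position_def
  proof (intro conj all imp)
    fix i :: 'm
    show "generically camera_coords UNIV (\<lambda>C. center_vector (C i) \<noteq> 0)"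
      by (rule generically_vector_nonzero[where a = "W i i i"])
         (intro polynomial_intros, simp, simp add: W_def center_axis_camera axis_eq_0_iff)
  next
    fix i j :: 'm assume "i \<noteq> j"
    then show "generically camera_coords UNIV (\<lambda>C.
        det4 (center_vector (C i)) (center_vector (C j)) (axis 3 1) (axis 4 1) \<noteq> 0)"
      by (intro generically_nonzero[where a = "W i j i"])
         (intro polynomial_intros, simp, simp add: W_def center_axis_camera det4_axes)
  next
    fix i j k :: 'm assume "distinct [i, j, k]"
    then have "i \<noteq> j" "j \<noteq> i" "i \<noteq> k" "k \<noteq> i" "j \<noteq> k" "k \<noteq> j" by auto
    then show "generically camera_coords UNIV (\<lambda>C.
        det4 (center_vector (C i)) (center_vector (C j)) (center_vector (C k)) (axis 4 1) \<noteq> 0)"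
      by (intro generically_nonzero[where a = "W i j k"])
         (intro polynomial_intros, simp, simp add: W_def center_axis_camera det4_axes)
  next
    fix i j k l :: 'm assume "distinct [i, j, k, l]"
    then have "j \<noteq> i" "k \<noteq> i" "k \<noteq> j" "l \<noteq> i" "l \<noteq> j" "l \<noteq> k" by auto
    then show "generically camera_coords UNIV (\<lambda>C. det4 (center_vector (C i))
        (center_vector (C j)) (center_vector (C k)) (center_vector (C l)) \<noteq> 0)"
      by (intro generically_nonzero[where a = "W i j k"])
         (intro polynomial_intros, simp, simp add: W_def center_axis_camera det4_axes)
  qed
qed

lemma image_of_other_center:
  assumes "centers_in_general_position C" "i \<noteq> j"
  shows "C i *v center_vector (C j) \<noteq> 0"
proof
  note centers_in_general_positionD(1)[OF assms(1)]
  moreover assume "C i *v center_vector (C j) = 0"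
  ultimately obtain t where "center_vector (C j) = t *s center_vector (C i)"
    using camera_kernel[of "C i"] by blast
  then have "det4 (center_vector (C i)) (center_vector (C j)) (axis 3 1) (axis 4 1) = 0"
    by simp
  then show False using centers_in_general_positionD(2)[OF assms] by simp
qed

lemma camera_arrangement_if_general_position:
  fixes C :: "'m::finite \<Rightarrow> complex^4^3"
  assumes "centers_in_general_position C"
  shows "\<exists>R. camera_arrangement C (\<lambda>i. center_vector (C i)) R"
proof -
  note c = centers_in_general_positionD(1)[OF assms]
  obtain R where R: "\<And>i a. C i *v (R i *v a) = a"
    using camera_right_inverse[OF c] by metis
  have "camera_arrangement C (\<lambda>i. center_vector (C i)) R"
  proof
    show "C i *v (R i *v a) = a" for i a by (rule R)
    show "C i *v x = 0 \<longleftrightarrow> (\<exists>t. x = t *s center_vector (C i))" for i x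
      by (rule camera_kernel[OF c])
    show "det3 (C i *v x) (C i *v y) (C i *v z) = det4 (center_vector (C i)) x y z" for i x y z
      by (rule camera_det3)
    show "C i *v center_vector (C j) \<noteq> 0" if "i \<noteq> j" for i j
      by (rule image_of_other_center[OF assms that])
    show "\<exists>e. det4 (center_vector (C i)) (center_vector (C j)) (center_vector (C k)) e \<noteq> 0"
      if "distinct [i, j, k]" for i j k
      using centers_in_general_positionD(3)[OF assms that] by blast
    show "det4 (center_vector (C i)) (center_vector (C j)) (center_vector (C k))
        (center_vector (C l)) \<noteq> 0" if "distinct [i, j, k, l]" for i j k l
      by (rule centers_in_general_positionD(4)[OF assms that])
  qed
  then show ?thesis by blast
qed

lemma center_vector_in_center:
  assumes "center_vector C \<noteq> 0"
  shows "center_vector C \<in> center C"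
  using camera_kernel[OF assms, of "center_vector C"] vector_smult_lid[of "center_vector C"]
  unfolding center_def mem_Collect_eq by metis

text \<open>Density holds since the condition is generic among all tuples of matrices. Four
  collinear centers would be combinations of two vectors, so their determinant would vanish.\<close>

lemma general_camera_set_general_position:
  "general_camera_set {C :: 'm::finite \<Rightarrow> _. centers_in_general_position C}"
  unfolding general_camera_set_def zariski_dense_in_def
proof (intro conjI ballI)
  note c = centers_in_general_positionD(1)
  show "{C :: 'm \<Rightarrow> _. centers_in_general_position C} \<subseteq> camera_tuples"
  proof
    fix C :: "'m \<Rightarrow> complex^4^3" assume "C \<in> {C. centers_in_general_position C}"
    then have C: "centers_in_general_position C" by simp
    have "inj (\<lambda>i. center (C i))"
    proof (rule injI)
      fix i j assume "center (C i) = center (C j)"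
      then have "center_vector (C j) \<in> center (C i)" using center_vector_in_center[OF c[OF C]] by simp
      then show "i = j" using image_of_other_center[OF C, of i j] by (auto simp: center_def)
    qed
    then show "C \<in> camera_tuples"
      using camera_rank[OF c[OF C]] by (simp add: camera_tuples_def)
  qed
  show "camera_tuples \<subseteq> zariski_closure camera_coords {C :: 'm \<Rightarrow> _. centers_in_general_position C}"
    using generically_dense[OF closed_under_lines_cameras generically_centers_in_general_position]
    by simp
  fix C :: "'m \<Rightarrow> complex^4^3" assume "C \<in> {C. centers_in_general_position C}"
  then have C: "centers_in_general_position C" by simp
  show "no_four_centers_collinear C"
    unfolding no_four_centers_collinear_def
  proof (intro allI impI notI)
    fix I :: "'m set" assume "card I = 4" and "\<exists>L\<in>grassmannian 2. \<forall>i\<in>I. center (C i) \<subseteq> L"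
    then obtain L where "L \<in> grassmannian 2" and L: "\<And>i. i \<in> I \<Longrightarrow> center (C i) \<subseteq> L" by blast
    then obtain u v where uv: "L = span2 u v"
      unfolding grassmannian_2_iff by blast
    obtain xs where xs: "set xs = I" "distinct xs" "length xs = 4"
      using \<open>card I = 4\<close> finite_distinct_list[of I] by (metis card.infinite distinct_card zero_neq_numeral)
    then obtain i j k l where ijkl: "xs = [i, j, k, l]"
      by (auto simp: numeral_eq_Suc length_Suc_conv)
    have "\<exists>a b. center_vector (C m) = a *s u + b *s v" if "m \<in> I" for m
      using L[OF that] center_vector_in_center[OF c[OF C], of m] unfolding uv span2_def by blast
    then obtain a b where ab: "\<And>m. m \<in> I \<Longrightarrow> center_vector (C m) = a m *s u + b m *s v"
      by metis
    have "i \<in> I" "j \<in> I" "k \<in> I" "l \<in> I"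
      using xs(1) by (auto simp: ijkl)
    then have "det4 (center_vector (C i)) (center_vector (C j)) (center_vector (C k))
        (center_vector (C l)) = 0"
      by (simp add: ab)
    then show False
      using centers_in_general_positionD(4)[OF C] xs(2) ijkl by blast
  qed
qed

section \<open>The theorem\<close>

text \<open>A list of images lifts to a list of preimages in the same order.\<close>

lemma image_mset_eq_mset:
  assumes "image_mset d M = mset ns"
  shows "\<exists>xs. mset xs = M \<and> map d xs = ns"
  using assms
proof (induction ns arbitrary: M)
  case (Cons n ns)
  then obtain M' x where M: "M = add_mset x M'" "d x = n" "image_mset d M' = mset ns"
    using msed_map_invR[of d M n "mset ns"] by auto
  obtain xs where "mset xs = M'" "map d xs = ns" using Cons.IH[OF M(3)] by blast
  with M show ?case by (intro exI[of _ "x # xs"]) simp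
qed simp

lemma nonzero_args_eq_mset:
  assumes "nonzero_args d = mset ns"
  shows "\<exists>xs. distinct xs \<and> map d xs = ns \<and> (\<forall>i. i \<notin> set xs \<longrightarrow> d i = 0)"
proof -
  obtain xs where xs: "mset xs = mset_set {i. d i \<noteq> 0}" "map d xs = ns"
    using image_mset_eq_mset assms unfolding nonzero_args_def by blast
  have set: "set xs = {i. d i \<noteq> 0}"
    using arg_cong[OF xs(1), of set_mset] by simp
  have "length xs = card (set xs)"
    using arg_cong[OF xs(1), of size] by (simp add: set)
  then have "distinct xs" by (simp add: card_distinct)
  with xs(2) set show ?thesis by auto
qed

theorem theorem4p1:
  assumes "CARD('m::finite) \<ge> 2"
  shows "\<exists>U :: ('m \<Rightarrow> complex^4^3) set. general_camera_set U \<and>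
    (\<forall>C\<in>U. \<forall>d :: 'm \<Rightarrow> nat.
      (nonzero_args d = {#2, 2#} \<longrightarrow> has_multidegree (line_multiview_variety C) d 1) \<and>
      (nonzero_args d = {#2, 1, 1#} \<longrightarrow> has_multidegree (line_multiview_variety C) d 1) \<and>
      (nonzero_args d = {#1, 1, 1, 1#} \<longrightarrow> has_multidegree (line_multiview_variety C) d 2))"
proof (intro exI[of _ "{C. centers_in_general_position C}"] conjI ballI allI impI)
  show "general_camera_set {C :: 'm \<Rightarrow> complex^4^3. centers_in_general_position C}"
    by (rule general_camera_set_general_position)
  fix C :: "'m \<Rightarrow> complex^4^3" and d :: "'m \<Rightarrow> nat"
  assume "C \<in> {C. centers_in_general_position C}"
  then obtain R where C: "camera_arrangement C (\<lambda>i. center_vector (C i)) R"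
    using camera_arrangement_if_general_position by blast
  show "has_multidegree (line_multiview_variety C) d 1" if "nonzero_args d = {#2, 2#}"
  proof -
    have "nonzero_args d = mset [2, 2]" using that by simp
    from nonzero_args_eq_mset[OF this] obtain xs
      where xs: "distinct xs" "map d xs = [2, 2]" "\<And>i. i \<notin> set xs \<Longrightarrow> d i = 0" by metis
    then obtain i j where "xs = [i, j]" by auto
    with xs show ?thesis by (intro camera_arrangement.multidegree_2_2[OF C, of i j]) auto
  qed
  show "has_multidegree (line_multiview_variety C) d 1" if "nonzero_args d = {#2, 1, 1#}"
  proof -
    have "nonzero_args d = mset [2, 1, 1]" using that by simp
    from nonzero_args_eq_mset[OF this] obtain xs
      where xs: "distinct xs" "map d xs = [2, 1, 1]" "\<And>i. i \<notin> set xs \<Longrightarrow> d i = 0" by metis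
    then obtain i j l where "xs = [i, j, l]" by auto
    with xs show ?thesis by (intro camera_arrangement.multidegree_2_1_1[OF C, of i j l]) auto
  qed
  show "has_multidegree (line_multiview_variety C) d 2" if "nonzero_args d = {#1, 1, 1, 1#}"
  proof -
    have "nonzero_args d = mset [1, 1, 1, 1]" using that by simp
    from nonzero_args_eq_mset[OF this] obtain xs
      where xs: "distinct xs" "map d xs = [1, 1, 1, 1]" "\<And>i. i \<notin> set xs \<Longrightarrow> d i = 0" by metis
    then obtain i j k l where "xs = [i, j, k, l]" by auto
    with xs show ?thesis by (intro camera_arrangement.multidegree_1_1_1_1[OF C, of i j k l]) auto
  qed
qed

end
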